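(* Let $m$ be a positive integer, $\lambda>m/2$ real, $\mu_0=1$, $\mu_1,\dots,\mu_m>0$, $\boldsymbol\mu=(\mu_0,\dots,\mu_m)$. The multiplication operator $M^{(\lambda,\boldsymbol\mu)}$, $(M^{(\lambda,\boldsymbol\mu)}f)(z)=zf(z)$, on the Hilbert space $\mathbf A^{(\lambda,\boldsymbol\mu)}(\mathbb D)$ is irreducible.
   Context: $\mathbb D$ is the open unit disc in $\mathbb C$. A bounded operator on a Hilbert space is irreducible if the only orthogonal projections commuting with it are $0$ and $I$. For $\alpha>0$, $A^{(\alpha)}(\mathbb D)$ is the Hilbert space of holomorphic functions on $\mathbb D$ with reproducing kernel $(1-z\bar\omega)^{-2\alpha}$. Put $2\lambda_j=2\lambda-m+2j$ for $0\le j\le m$ and $(x)_n=x(x+1)\cdots(x+n-1)$. Vectors in $\mathbb C^{m+1}$ have components indexed by $0,\dots,m$. Define $\Gamma_j:A^{(\lambda_j)}(\mathbb D)\to \mathrm{Hol}(\mathbb D,\mathbb C^{m+1})$ by $(\Gamma_jf)_\ell=\binom{\ell}{j}\frac{1}{(2\lambda_j)_{\ell-j}}f^{(\ell-j)}$ if $\ell\ge j$ and $(\Gamma_jf)_\ell=0$ if $\ell<j$. Each $\Gamma_j$ is injective and the sum of the images of $\Gamma_0,\dots,\Gamma_m$ is direct. $\mathbf A^{(\lambda,\boldsymbol\mu)}(\mathbb D)$ is this direct sum of images, with the inner product $\langle\sum_j\Gamma_jf_j,\sum_j\Gamma_jg_j\rangle=\sum_j\mu_j^{-2}\langle f_j,g_j\rangle_{A^{(\lambda_j)}}$;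 it is a Hilbert space of $\mathbb C^{m+1}$-valued holomorphic functions with reproducing kernel $\mathbf B^{(\lambda,\boldsymbol\mu)}=\sum_{j=0}^m\mu_j^2\,\mathbf B^{(\lambda_j)}$, where $\mathbf B^{(\lambda_j)}$ is the reproducing kernel of the image of $\Gamma_j$ equipped with the inner product transferred from $A^{(\lambda_j)}(\mathbb D)$. The operator $M^{(\lambda,\boldsymbol\mu)}$ is bounded on this space. *)

theory Defs
  imports "HOL-Analysis.Analysis" "HOL-Complex_Analysis.Complex_Analysis"
    "HOL-Library.Function_Algebras"
begin

text \<open>Complex vector spaces as a type class, so that scalar-valued and vector-valued functions
  on the disc are treated uniformly; addition of functions is pointwise.\<close>

class complex_vector = ab_group_add +
  fixes scaleC :: "complex \<Rightarrow> 'a \<Rightarrow> 'a"  (infixr \<open>*\<^sub>C\<close> 75)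
  assumes scaleC_add_right: "c *\<^sub>C (x + y) = c *\<^sub>C x + c *\<^sub>C y"
    and scaleC_add_left: "(b + c) *\<^sub>C x = b *\<^sub>C x + c *\<^sub>C x"
    and scaleC_scaleC: "b *\<^sub>C c *\<^sub>C x = (b * c) *\<^sub>C x"
    and scaleC_one: "1 *\<^sub>C x = x"

instantiation complex :: complex_vector
begin
definition scaleC_complex :: "complex \<Rightarrow> complex \<Rightarrow> complex"
  where "scaleC_complex c x = c * x"
instance by standard (simp_all add: scaleC_complex_def algebra_simps)
end

instantiation "fun" :: (type, complex_vector) complex_vector
begin
definition scaleC_fun :: "complex \<Rightarrow> ('a \<Rightarrow> 'b) \<Rightarrow> 'a \<Rightarrow> 'b"
  where "scaleC_fun c f = (\<lambda>x. c *\<^sub>C f x)"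
instance
  by standard (simp_all add: scaleC_fun_def fun_eq_iff scaleC_add_right scaleC_add_left
      scaleC_scaleC scaleC_one)
end

text \<open>A complex inner product space carried by a set of vectors. The values of the inner product
  outside the carrier are irrelevant.\<close>

record 'a ip_space =
  vecs :: "'a set"
  ip :: "'a \<Rightarrow> 'a \<Rightarrow> complex"

definition hnorm :: "'a ip_space \<Rightarrow> 'a \<Rightarrow> real"
  where "hnorm H f = sqrt (Re (ip H f f))"

definition hilbert_space :: "('a::complex_vector) ip_space \<Rightarrow> bool"
  where "hilbert_space H \<longleftrightarrow>
    0 \<in> vecs H \<and>
    (\<forall>f\<in>vecs H. \<forall>g\<in>vecs H. f + g \<in> vecs H) \<and>
    (\<forall>c. \<forall>f\<in>vecs H. c *\<^sub>C f \<in> vecs H) \<and>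
    (\<forall>f\<in>vecs H. \<forall>g\<in>vecs H. \<forall>h\<in>vecs H. ip H (f + g) h = ip H f h + ip H g h) \<and>
    (\<forall>c. \<forall>f\<in>vecs H. \<forall>g\<in>vecs H. ip H (c *\<^sub>C f) g = c * ip H f g) \<and>
    (\<forall>f\<in>vecs H. \<forall>g\<in>vecs H. ip H g f = cnj (ip H f g)) \<and>
    (\<forall>f\<in>vecs H. f \<noteq> 0 \<longrightarrow> 0 < Re (ip H f f)) \<and>
    (\<forall>X. (\<forall>n. X n \<in> vecs H) \<and>
         (\<forall>e>0. \<exists>N. \<forall>i\<ge>N. \<forall>k\<ge>N. hnorm H (X i - X k) < e) \<longrightarrow>
         (\<exists>f\<in>vecs H. (\<lambda>n::nat. hnorm H (X n - f)) \<longlonglongrightarrow> 0))"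

definition bounded_operator :: "('a::complex_vector) ip_space \<Rightarrow> ('a \<Rightarrow> 'a) \<Rightarrow> bool"
  where "bounded_operator H T \<longleftrightarrow>
    (\<forall>f\<in>vecs H. T f \<in> vecs H) \<and>
    (\<forall>f\<in>vecs H. \<forall>g\<in>vecs H. T (f + g) = T f + T g) \<and>
    (\<forall>c. \<forall>f\<in>vecs H. T (c *\<^sub>C f) = c *\<^sub>C T f) \<and>
    (\<exists>C. \<forall>f\<in>vecs H. hnorm H (T f) \<le> C * hnorm H f)"

definition orthogonal_projection :: "('a::complex_vector) ip_space \<Rightarrow> ('a \<Rightarrow> 'a) \<Rightarrow> bool"
  where "orthogonal_projection H P \<longleftrightarrow>
    bounded_operator H P \<and>
    (\<forall>f\<in>vecs H. P (P f) = P f) \<and>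
    (\<forall>f\<in>vecs H. \<forall>g\<in>vecs H. ip H (P f) g = ip H f (P g))"

definition irreducible_operator :: "('a::complex_vector) ip_space \<Rightarrow> ('a \<Rightarrow> 'a) \<Rightarrow> bool"
  where "irreducible_operator H T \<longleftrightarrow>
    bounded_operator H T \<and>
    (\<forall>P. orthogonal_projection H P \<and> (\<forall>f\<in>vecs H. P (T f) = T (P f)) \<longrightarrow>
         (\<forall>f\<in>vecs H. P f = 0) \<or> (\<forall>f\<in>vecs H. P f = f))"

abbreviation unit_disc :: "complex set"
  where "unit_disc \<equiv> ball 0 1"

text \<open>\<open>disc_kernel \<alpha> w\<close> is the kernel at \<open>w\<close>, as a function of the first variable. Functions
  on the disc are total functions vanishing off the disc, so that equality is
  equality on the disc. The power is the principal one: \<open>1 - z * cnj w\<close> has positive real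
  part.\<close>

definition disc_kernel :: "real \<Rightarrow> complex \<Rightarrow> complex \<Rightarrow> complex"
  where "disc_kernel \<alpha> w =
    (\<lambda>z. if z \<in> unit_disc then (1 - z * cnj w) powr of_real (- 2 * \<alpha>) else 0)"

definition is_disc_space :: "real \<Rightarrow> (complex \<Rightarrow> complex) ip_space \<Rightarrow> bool"
  where "is_disc_space \<alpha> H \<longleftrightarrow>
    hilbert_space H \<and>
    (\<forall>f\<in>vecs H. f holomorphic_on unit_disc \<and> (\<forall>z. z \<notin> unit_disc \<longrightarrow> f z = 0)) \<and>
    (\<forall>w\<in>unit_disc. disc_kernel \<alpha> w \<in> vecs H \<and> (\<forall>f\<in>vecs H. ip H f (disc_kernel \<alpha> w) = f w))"

text \<open>A Hilbert space of functions is determined by its reproducing kernel, so the choice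
  only affects the values of the inner product outside the carrier.\<close>

definition disc_space :: "real \<Rightarrow> (complex \<Rightarrow> complex) ip_space"
  where "disc_space \<alpha> = (SOME H. is_disc_space \<alpha> H)"

definition lamj :: "nat \<Rightarrow> real \<Rightarrow> nat \<Rightarrow> real"
  where "lamj m la j = (2 * la - real m + 2 * real j) / 2"

text \<open>A vector of \<open>\<complex>\<^sup>m\<^sup>+\<^sup>1\<close> is a function on the naturals vanishing at
  all indices above \<open>m\<close>.\<close>

definition Gam :: "nat \<Rightarrow> real \<Rightarrow> nat \<Rightarrow> (complex \<Rightarrow> complex) \<Rightarrow> complex \<Rightarrow> nat \<Rightarrow> complex"
  where "Gam m la j f = (\<lambda>z l.
    if z \<in> unit_disc \<and> j \<le> l \<and> l \<le> m
    then of_nat (l choose j) * (1 / of_real (pochhammer (2 * lamj m la j) (l - j)))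
           * (deriv ^^ (l - j)) f z
    else 0)"

definition is_decomposition ::
    "nat \<Rightarrow> real \<Rightarrow> (complex \<Rightarrow> nat \<Rightarrow> complex) \<Rightarrow> (nat \<Rightarrow> complex \<Rightarrow> complex) \<Rightarrow> bool"
  where "is_decomposition m la F f \<longleftrightarrow>
    (\<forall>j\<le>m. f j \<in> vecs (disc_space (lamj m la j))) \<and> F = (\<Sum>j\<le>m. Gam m la j (f j))"

text \<open>The \<open>f j\<close> with \<open>j \<le> m\<close> are determined by \<open>F\<close>: each \<open>Gam m la j\<close> is injective and the sum of
  the images is direct.\<close>

definition decomposition :: "nat \<Rightarrow> real \<Rightarrow> (complex \<Rightarrow> nat \<Rightarrow> complex) \<Rightarrow> nat \<Rightarrow> complex \<Rightarrow> complex"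
  where "decomposition m la F = (SOME f. is_decomposition m la F f)"

definition sum_space :: "nat \<Rightarrow> real \<Rightarrow> (nat \<Rightarrow> real) \<Rightarrow> (complex \<Rightarrow> nat \<Rightarrow> complex) ip_space"
  where "sum_space m la \<mu> =
    \<lparr> vecs = {F. \<exists>f. is_decomposition m la F f},
      ip = (\<lambda>F G. \<Sum>j\<le>m. of_real (1 / (\<mu> j)\<^sup>2) *
              ip (disc_space (lamj m la j)) (decomposition m la F j) (decomposition m la G j)) \<rparr>"

definition mult_op :: "(complex \<Rightarrow> nat \<Rightarrow> complex) \<Rightarrow> complex \<Rightarrow> nat \<Rightarrow> complex"
  where "mult_op F = (\<lambda>z. z *\<^sub>C F z)"

end

theory Submission imports Defs begin

text \<open>Expanding in powers of \<open>z\<close> identifies \<open>disc_space \<alpha>\<close> with a weighted \<open>\<ell>\<^sup>2\<close> space, on which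
  differentiation raises \<open>\<alpha>\<close> by one and is bounded. Solving the triangular system that relates a
  vector to its decomposition, the sum space consists of all functions whose \<open>l\<close>-th component lies
  in \<open>disc_space (lamj m la l)\<close>, with an equivalent norm; so multiplication by \<open>z\<close> is bounded.

  Let \<open>P\<close> be a projection commuting with \<open>M\<close>, multiplication by \<open>z\<close>. It preserves the orthogonal
  complement of the range of \<open>M\<close>, which is spanned by the kernels \<open>k\<^sub>l\<close> of the functionals
  \<open>F \<mapsto> F\<^sub>l(0)\<close>, and every \<open>k\<^sub>l\<close> is homogeneous of degree \<open>l\<close>, where \<open>z\<^sup>n\<close> in component \<open>l\<close> has
  degree \<open>n + l\<close>; different degrees are orthogonal. In \<open>M\<^sup>b k\<^sub>l\<close> the component \<open>0\<close>, which is
  \<open>z\<^sup>b\<^sup>+\<^sup>l\<close>, dominates in norm as \<open>b\<close> grows, so vectors \<open>M\<^sup>a k\<^sub>i\<close> and \<open>M\<^sup>b k\<^sub>j\<close> of the same large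
  degree are not orthogonal. Suppose \<open>F\<close> in the range and \<open>G\<close> in the kernel of \<open>P\<close> are
  nonzero combinations of the \<open>k\<^sub>l\<close>. Shifting so that the top degree of \<open>M\<^sup>a F\<close> is the bottom
  degree of \<open>M\<^sup>b G\<close> leaves a single nonzero term in their inner product, which however vanishes.
  Hence \<open>P\<close> or \<open>I - P\<close> kills all \<open>k\<^sub>l\<close>, and then its range lies in the range of every \<open>M\<^sup>n\<close>, so
  it is \<open>0\<close>.\<close>

section \<open>Inner product spaces and reproducing kernels\<close>

lemma scaleC_zero_left [simp]: "0 *\<^sub>C (x::'a::complex_vector) = 0"
  by (metis add_cancel_left_right scaleC_add_left add_0)

lemma scaleC_zero_right [simp]: "c *\<^sub>C (0::'a::complex_vector) = 0"
  by (metis add_cancel_left_right scaleC_add_right add_0)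

lemma scaleC_minus_one: "(-1) *\<^sub>C (x::'a::complex_vector) = - x"
  by (metis add.right_inverse eq_neg_iff_add_eq_0 scaleC_add_left scaleC_one scaleC_zero_left add.commute)

lemma diff_eq_scaleC: "x - y = x + (-1) *\<^sub>C (y::'a::complex_vector)"
  by (simp add: scaleC_minus_one)

lemma scaleC_diff_right: "c *\<^sub>C (x - y) = c *\<^sub>C x - c *\<^sub>C (y::'a::complex_vector)"
  by (metis add_diff_cancel_right' diff_add_cancel scaleC_add_right)

lemma scaleC_sum_right: "c *\<^sub>C (\<Sum>i\<in>A. f i) = (\<Sum>i\<in>A. c *\<^sub>C (f i :: 'a::complex_vector))"
  using sum_comp_morphism[of "\<lambda>x. c *\<^sub>C x" f A] by (simp add: o_def scaleC_add_right)

text \<open>\<open>hilbert_space\<close> without completeness, so that it applies to the weighted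
  spaces while their completeness is still being proved, and to the sum space from its algebra
  alone.\<close>

locale inner_product_space =
  fixes H :: "('a::complex_vector) ip_space"
  assumes zero_mem [simp]: "0 \<in> vecs H"
    and add_mem [simp]: "\<lbrakk>f \<in> vecs H; g \<in> vecs H\<rbrakk> \<Longrightarrow> f + g \<in> vecs H"
    and scale_mem [simp]: "f \<in> vecs H \<Longrightarrow> c *\<^sub>C f \<in> vecs H"
    and ip_add_left: "\<lbrakk>f \<in> vecs H; g \<in> vecs H; h \<in> vecs H\<rbrakk> \<Longrightarrow> ip H (f + g) h = ip H f h + ip H g h"
    and ip_scale_left: "\<lbrakk>f \<in> vecs H; g \<in> vecs H\<rbrakk> \<Longrightarrow> ip H (c *\<^sub>C f) g = c * ip H f g"
    and ip_commute: "\<lbrakk>f \<in> vecs H; g \<in> vecs H\<rbrakk> \<Longrightarrow> ip H g f = cnj (ip H f g)"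
    and ip_pos: "\<lbrakk>f \<in> vecs H; f \<noteq> 0\<rbrakk> \<Longrightarrow> 0 < Re (ip H f f)"
begin

lemma diff_mem [simp]: "\<lbrakk>f \<in> vecs H; g \<in> vecs H\<rbrakk> \<Longrightarrow> f - g \<in> vecs H"
  by (simp add: diff_eq_scaleC)

lemma sum_mem [simp]: "(\<And>i. i \<in> A \<Longrightarrow> f i \<in> vecs H) \<Longrightarrow> sum f A \<in> vecs H"
  by (induction A rule: infinite_finite_induct) auto

lemma ip_add_right:
  "\<lbrakk>f \<in> vecs H; g \<in> vecs H; h \<in> vecs H\<rbrakk> \<Longrightarrow> ip H f (g + h) = ip H f g + ip H f h"
  by (metis add_mem complex_cnj_add ip_add_left ip_commute)

lemma ip_scale_right: "\<lbrakk>f \<in> vecs H; g \<in> vecs H\<rbrakk> \<Longrightarrow> ip H f (c *\<^sub>C g) = cnj c * ip H f g"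
  by (metis scale_mem complex_cnj_mult ip_scale_left ip_commute)

lemma ip_diff_left:
  "\<lbrakk>f \<in> vecs H; g \<in> vecs H; h \<in> vecs H\<rbrakk> \<Longrightarrow> ip H (f - g) h = ip H f h - ip H g h"
  using ip_add_left[of f "(-1) *\<^sub>C g" h] ip_scale_left[of g h "-1"] scale_mem[of g "-1"]
  by (simp add: scaleC_minus_one)

lemma ip_diff_right:
  "\<lbrakk>f \<in> vecs H; g \<in> vecs H; h \<in> vecs H\<rbrakk> \<Longrightarrow> ip H f (g - h) = ip H f g - ip H f h"
  using ip_add_right[of f g "(-1) *\<^sub>C h"] ip_scale_right[of f h "-1"] scale_mem[of h "-1"]
  by (simp add: scaleC_minus_one)

lemma ip_zero_left [simp]: "g \<in> vecs H \<Longrightarrow> ip H 0 g = 0"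
  using ip_scale_left[of 0 g 0] by simp

lemma ip_zero_right [simp]: "g \<in> vecs H \<Longrightarrow> ip H g 0 = 0"
  using ip_scale_right[of g 0 0] by simp

lemma ip_sum_left:
  "\<lbrakk>\<And>i. i \<in> A \<Longrightarrow> f i \<in> vecs H; g \<in> vecs H\<rbrakk> \<Longrightarrow> ip H (sum f A) g = (\<Sum>i\<in>A. ip H (f i) g)"
  by (induction A rule: infinite_finite_induct) (auto simp: ip_add_left)

lemma ip_sum_right:
  "\<lbrakk>\<And>i. i \<in> A \<Longrightarrow> f i \<in> vecs H; g \<in> vecs H\<rbrakk> \<Longrightarrow> ip H g (sum f A) = (\<Sum>i\<in>A. ip H g (f i))"
  by (induction A rule: infinite_finite_induct) (auto simp: ip_add_right)

lemma Re_ip_self_nonneg: "f \<in> vecs H \<Longrightarrow> 0 \<le> Re (ip H f f)"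
  by (metis ip_pos ip_zero_left order_less_imp_le zero_complex.simps(1) order_refl)

lemma hnorm_nonneg [simp]: "f \<in> vecs H \<Longrightarrow> 0 \<le> hnorm H f"
  by (simp add: hnorm_def Re_ip_self_nonneg)

lemma hnorm_power2: "f \<in> vecs H \<Longrightarrow> (hnorm H f)\<^sup>2 = Re (ip H f f)"
  by (simp add: hnorm_def Re_ip_self_nonneg)

lemma ip_self: "f \<in> vecs H \<Longrightarrow> ip H f f = of_real ((hnorm H f)\<^sup>2)"
  using ip_commute[of f f] by (simp add: complex_eq_iff hnorm_power2)

lemma hnorm_zero [simp]: "hnorm H 0 = 0"
  by (simp add: hnorm_def)

lemma hnorm_eq_0_iff [simp]: "f \<in> vecs H \<Longrightarrow> hnorm H f = 0 \<longleftrightarrow> f = 0"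
  by (metis hnorm_power2 hnorm_zero ip_pos order_less_irrefl power_zero_numeral)

lemma hnorm_scale: "f \<in> vecs H \<Longrightarrow> hnorm H (c *\<^sub>C f) = norm c * hnorm H f"
proof -
  assume f: "f \<in> vecs H"
  have "of_real ((hnorm H (c *\<^sub>C f))\<^sup>2) = (c * cnj c) * of_real ((hnorm H f)\<^sup>2)"
    unfolding ip_self[OF f, symmetric] ip_self[OF scale_mem[OF f], symmetric]
    using f by (simp add: ip_scale_left ip_scale_right)
  also have "\<dots> = complex_of_real ((norm c * hnorm H f)\<^sup>2)"
    by (simp add: complex_norm_square[symmetric] power_mult_distrib)
  finally have "(hnorm H (c *\<^sub>C f))\<^sup>2 = (norm c * hnorm H f)\<^sup>2"
    by (simp only: of_real_eq_iff)
  with f show ?thesis by (simp add: power2_eq_iff_nonneg)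
qed

lemma hnorm_add_power2:
  "\<lbrakk>f \<in> vecs H; g \<in> vecs H\<rbrakk> \<Longrightarrow> (hnorm H (f + g))\<^sup>2 = (hnorm H f)\<^sup>2 + 2 * Re (ip H f g) + (hnorm H g)\<^sup>2"
  using ip_commute[of f g] by (simp add: hnorm_power2 ip_add_left ip_add_right)

lemma hnorm_diff_power2:
  "\<lbrakk>f \<in> vecs H; g \<in> vecs H\<rbrakk> \<Longrightarrow> (hnorm H (f - g))\<^sup>2 = (hnorm H f)\<^sup>2 - 2 * Re (ip H f g) + (hnorm H g)\<^sup>2"
  using ip_commute[of f g] by (simp add: hnorm_power2 ip_diff_left ip_diff_right)

text \<open>Pythagoras for the part of f orthogonal to g. Nonnegativity of the left side gives
  Cauchy-Schwarz; in the density lemma below, the subtracted term shows that a vector of minimal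
  norm must be orthogonal.\<close>

lemma hnorm_diff_projection_power2:
  assumes f: "f \<in> vecs H" and g: "g \<in> vecs H" and "g \<noteq> 0"
  shows "(hnorm H (f - (ip H f g / ip H g g) *\<^sub>C g))\<^sup>2 = (hnorm H f)\<^sup>2 - (norm (ip H f g))\<^sup>2 / (hnorm H g)\<^sup>2"
proof -
  have g0: "hnorm H g \<noteq> 0" using assms by simp
  have "Re (cnj (ip H f g / ip H g g) * ip H f g) = (norm (ip H f g))\<^sup>2 / (hnorm H g)\<^sup>2"
    using g unfolding cmod_power2
      by (simp add: ip_self power2_eq_square flip: of_real_power of_real_divide)
  moreover have "(norm (ip H f g / ip H g g) * hnorm H g)\<^sup>2 = (norm (ip H f g))\<^sup>2 / (hnorm H g)\<^sup>2"
    using g0 g by (simp add: ip_self norm_divide norm_power norm_mult power_mult_distrib power_divide power2_eq_square)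
  ultimately show ?thesis
    using f g by (simp add: hnorm_diff_power2 ip_scale_right hnorm_scale del: complex_cnj_divide)
qed

lemma cauchy_schwarz:
  assumes f: "f \<in> vecs H" and g: "g \<in> vecs H"
  shows "norm (ip H f g) \<le> hnorm H f * hnorm H g"
proof (cases "g = 0")
  case False
  then have "hnorm H g > 0" using g by (simp add: less_le)
  moreover have "0 \<le> (hnorm H f)\<^sup>2 - (norm (ip H f g))\<^sup>2 / (hnorm H g)\<^sup>2"
    unfolding hnorm_diff_projection_power2[OF f g False, symmetric] by simp
  ultimately have "(norm (ip H f g))\<^sup>2 \<le> (hnorm H f * hnorm H g)\<^sup>2"
    by (simp add: pos_divide_le_eq power_mult_distrib)
  then show ?thesis by (rule power2_le_imp_le) (use f g in simp)
qed (use f in simp)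

lemma hnorm_triangle:
  assumes f: "f \<in> vecs H" and g: "g \<in> vecs H"
  shows "hnorm H (f + g) \<le> hnorm H f + hnorm H g"
proof (rule power2_le_imp_le)
  have "Re (ip H f g) \<le> hnorm H f * hnorm H g"
    by (rule order_trans[OF complex_Re_le_cmod cauchy_schwarz[OF f g]])
  then show "(hnorm H (f + g))\<^sup>2 \<le> (hnorm H f + hnorm H g)\<^sup>2"
    using f g by (simp add: hnorm_add_power2 power2_sum)
qed (use f g in simp)

lemma hnorm_triangle_diff:
  assumes "f \<in> vecs H" and "g \<in> vecs H"
  shows "hnorm H (f - g) \<le> hnorm H f + hnorm H g"
  using hnorm_triangle[of f "(-1) *\<^sub>C g"] assms by (simp add: diff_eq_scaleC[symmetric] hnorm_scale)

lemma hnorm_sum_le: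
  "(\<And>i. i \<in> A \<Longrightarrow> f i \<in> vecs H) \<Longrightarrow> hnorm H (sum f A) \<le> (\<Sum>i\<in>A. hnorm H (f i))"
proof (induction A rule: infinite_finite_induct)
  case (insert x A)
  then show ?case using hnorm_triangle[of "f x" "sum f A"] by fastforce
qed auto

lemma tendsto_ip_left:
  assumes X: "\<And>n. X n \<in> vecs H" and f: "f \<in> vecs H" and g: "g \<in> vecs H"
    and lim: "(\<lambda>n. hnorm H (X n - f)) \<longlonglongrightarrow> 0"
  shows "(\<lambda>n. ip H (X n) g) \<longlonglongrightarrow> ip H f g"
proof -
  have "(\<lambda>n. ip H (X n) g - ip H f g) \<longlonglongrightarrow> 0"
  proof (rule Lim_null_comparison)
    show "\<forall>\<^sub>F n in sequentially. norm (ip H (X n) g - ip H f g) \<le> hnorm H (X n - f) * hnorm H g"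
      using cauchy_schwarz[of "X n - f" g for n] X f g
        by (intro always_eventually allI) (simp add: ip_diff_left)
    show "(\<lambda>n. hnorm H (X n - f) * hnorm H g) \<longlonglongrightarrow> 0"
      using tendsto_mult_right[OF lim] by simp
  qed
  then show ?thesis by (simp add: LIM_zero_iff)
qed

end

section \<open>Completeness: dense subspaces and uniqueness of reproducing kernel spaces\<close>

lemma hilbert_space_imp_inner:
  assumes "hilbert_space H"
  shows "inner_product_space H"
proof
  note h = assms[unfolded hilbert_space_def]
  show "0 \<in> vecs H" by (rule h[THEN conjunct1])
  show "f + g \<in> vecs H" if "f \<in> vecs H" "g \<in> vecs H" for f g
    by (rule h[THEN conjunct2, THEN conjunct1, THEN bspec, THEN bspec, OF that])
  show "c *\<^sub>C f \<in> vecs H" if "f \<in> vecs H" for f c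
    by (rule h[THEN conjunct2, THEN conjunct2, THEN conjunct1, THEN spec, THEN bspec, OF that])
  show "ip H (f + g) h = ip H f h + ip H g h" if "f \<in> vecs H" "g \<in> vecs H" "h \<in> vecs H" for f g h
    by (rule h[THEN conjunct2, THEN conjunct2, THEN conjunct2, THEN conjunct1, THEN bspec, THEN bspec, THEN bspec, OF that])
  show "ip H (c *\<^sub>C f) g = c * ip H f g" if "f \<in> vecs H" "g \<in> vecs H" for f g c
    by (rule h[THEN conjunct2, THEN conjunct2, THEN conjunct2, THEN conjunct2, THEN conjunct1, THEN spec, THEN bspec, THEN bspec, OF that])
  show "ip H g f = cnj (ip H f g)" if "f \<in> vecs H" "g \<in> vecs H" for f g
    by (rule h[THEN conjunct2, THEN conjunct2, THEN conjunct2, THEN conjunct2, THEN conjunct2, THEN conjunct1, THEN bspec, THEN bspec, OF that])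
  show "0 < Re (ip H f f)" if "f \<in> vecs H" "f \<noteq> 0" for f
    by (rule h[THEN conjunct2, THEN conjunct2, THEN conjunct2, THEN conjunct2, THEN conjunct2, THEN conjunct2, THEN conjunct1, THEN bspec, THEN mp, OF that])
qed

lemma hilbert_space_complete:
  assumes "hilbert_space H" "\<And>n. X n \<in> vecs H"
    "\<And>e. e > 0 \<Longrightarrow> \<exists>N. \<forall>i\<ge>N. \<forall>k\<ge>N. hnorm H (X i - X k) < e"
  shows "\<exists>f\<in>vecs H. (\<lambda>n::nat. hnorm H (X n - f)) \<longlonglongrightarrow> 0"
proof -
  have "(\<forall>n. X n \<in> vecs H) \<and> (\<forall>e>0. \<exists>N. \<forall>i\<ge>N. \<forall>k\<ge>N. hnorm H (X i - X k) < e) \<longrightarrow>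
      (\<exists>f\<in>vecs H. (\<lambda>n. hnorm H (X n - f)) \<longlonglongrightarrow> 0)"
    using assms(1) unfolding hilbert_space_def by (elim conjE allE[of _ X])
  with assms(2,3) show ?thesis by simp
qed

text \<open>A sequence in S minimizing the distance to f is Cauchy by the parallelogram law. Its
  limit g makes f - g orthogonal to S, so f = g by \<open>orth\<close>.\<close>

lemma hilbert_space_dense_if_orthogonal_trivial:
  assumes H: "hilbert_space H" and S: "S \<subseteq> vecs H" "0 \<in> S"
    and S_add: "\<And>s t. s \<in> S \<Longrightarrow> t \<in> S \<Longrightarrow> s + t \<in> S"
    and S_scale: "\<And>c s. s \<in> S \<Longrightarrow> c *\<^sub>C s \<in> S"
    and orth: "\<And>h. h \<in> vecs H \<Longrightarrow> (\<And>s. s \<in> S \<Longrightarrow> ip H h s = 0) \<Longrightarrow> h = 0"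
    and f: "f \<in> vecs H"
  obtains X where "\<And>n::nat. X n \<in> S" "(\<lambda>n. hnorm H (X n - f)) \<longlonglongrightarrow> 0"
proof -
  interpret inner_product_space H by (rule hilbert_space_imp_inner[OF H])
  define d where "d = (INF s\<in>S. hnorm H (f - s))"
  have bdd: "bdd_below ((\<lambda>s. hnorm H (f - s)) ` S)"
    using S f by (intro bdd_belowI2[of _ 0]) auto
  have d_le: "d \<le> hnorm H (f - s)" if "s \<in> S" for s
    unfolding d_def using bdd that by (rule cINF_lower)
  have d0: "d \<ge> 0" unfolding d_def using S f by (intro cINF_greatest) auto
  \<comment> \<open>The tolerance sits under the root because the parallelogram law consumes squared
    distances.\<close>
  have "\<exists>s\<in>S. hnorm H (f - s) < sqrt (d\<^sup>2 + 1 / Suc n)" for n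
  proof -
    have "d < sqrt (d\<^sup>2 + 1 / Suc n)" using d0 by (intro real_less_rsqrt) simp
    then show ?thesis unfolding d_def using S(2) bdd by (subst (asm) cINF_less_iff) auto
  qed
  then obtain X where XS: "\<And>n. X n \<in> S" and X_less: "\<And>n. hnorm H (f - X n) < sqrt (d\<^sup>2 + 1 / Suc n)"
    by metis
  have X: "X n \<in> vecs H" for n using XS S by blast
  have X_less2: "(hnorm H (f - X n))\<^sup>2 < d\<^sup>2 + 1 / Suc n" for n
    using power_strict_mono[OF X_less[of n], of 2] X f by simp
  \<comment> \<open>Parallelogram law for f - X i and f - X k: their sum is twice the difference of
    f and the midpoint of X i and X k, which lies in S and so has distance at least d from
    f.\<close>
  have close: "(hnorm H (X i - X k))\<^sup>2 \<le> 2 / Suc i + 2 / Suc k" for i k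
  proof -
    let ?u = "f - X i" and ?v = "f - X k"
    have "?u + ?v = 2 *\<^sub>C (f - (1/2) *\<^sub>C (X i + X k))"
    proof -
      have "(2::complex) *\<^sub>C h = h + h" for h :: 'a
        using scaleC_add_left[of 1 1 h] by (simp add: scaleC_one)
      moreover have "(2::complex) *\<^sub>C (1/2) *\<^sub>C h = h" for h :: 'a
        by (simp add: scaleC_scaleC scaleC_one)
      ultimately show ?thesis
        by (simp add: scaleC_diff_right algebra_simps)
    qed
    moreover have "d \<le> hnorm H (f - (1/2) *\<^sub>C (X i + X k))"
      using XS S_add S_scale d_le by blast
    ultimately have "2 * d \<le> hnorm H (?u + ?v)"
      using X f by (simp add: hnorm_scale)
    then have "4 * d\<^sup>2 \<le> (hnorm H (?u + ?v))\<^sup>2"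
      using d0 power_mono[of "2 * d" _ 2] by simp
    moreover have "(hnorm H (X i - X k))\<^sup>2 = (hnorm H (?v - ?u))\<^sup>2" by simp
    moreover have "(hnorm H (?v - ?u))\<^sup>2 + (hnorm H (?u + ?v))\<^sup>2 = 2 * (hnorm H ?u)\<^sup>2 + 2 * (hnorm H ?v)\<^sup>2"
      using hnorm_add_power2[of ?u ?v] hnorm_diff_power2[of ?v ?u] ip_commute[of ?u ?v] X f by simp
    ultimately show ?thesis using X_less2[of i] X_less2[of k] by simp
  qed
  have "\<exists>N. \<forall>i\<ge>N. \<forall>k\<ge>N. hnorm H (X i - X k) < e" if "e > 0" for e
  proof -
    obtain N where N: "inverse (real (Suc N)) < e\<^sup>2 / 4"
      using reals_Archimedean[of "e\<^sup>2 / 4"] \<open>e > 0\<close> by auto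
    have "hnorm H (X i - X k) < e" if "i \<ge> N" "k \<ge> N" for i k
    proof (rule power2_less_imp_less)
      have "2 / Suc i \<le> 2 * inverse (real (Suc N))" "2 / Suc k \<le> 2 * inverse (real (Suc N))"
        using that by (auto simp: field_simps)
      then show "(hnorm H (X i - X k))\<^sup>2 < e\<^sup>2" using close[of i k] N by linarith
    qed (use \<open>e > 0\<close> in simp)
    then show ?thesis by blast
  qed
  from hilbert_space_complete[OF H X this]
  obtain g where g: "g \<in> vecs H" and lim: "(\<lambda>n. hnorm H (X n - g)) \<longlonglongrightarrow> 0" by blast
  let ?h = "f - g"
  have h: "?h \<in> vecs H" using f g by simp
  have "hnorm H ?h \<le> d"
  proof (rule LIMSEQ_le_const)
    have "(\<lambda>n. sqrt (d\<^sup>2 + 1 / Suc n) + hnorm H (X n - g)) \<longlonglongrightarrow> sqrt (d\<^sup>2 + 0) + 0"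
      by (intro tendsto_intros lim LIMSEQ_Suc[OF lim_1_over_n])
    then show "(\<lambda>n. sqrt (d\<^sup>2 + 1 / Suc n) + hnorm H (X n - g)) \<longlonglongrightarrow> d" using d0 by simp
    have "hnorm H ?h \<le> hnorm H (f - X n) + hnorm H (X n - g)" for n
      using hnorm_triangle[of "f - X n" "X n - g"] X f g by simp
    then show "\<exists>N. \<forall>n\<ge>N. hnorm H ?h \<le> sqrt (d\<^sup>2 + 1 / Suc n) + hnorm H (X n - g)"
      using X_less by (intro exI allI impI) (meson add_right_mono less_imp_le order_trans)
  qed
  \<comment> \<open>The limit g need not lie in S, so the bound is taken at X n + s, which does, and
    passed to the limit.\<close>
  moreover have d_le_h: "d \<le> hnorm H (?h - s)" if s: "s \<in> S" for s
  proof (rule LIMSEQ_le_const)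
    have sv: "s \<in> vecs H" using s S by blast
    show "(\<lambda>n. hnorm H (?h - s) + hnorm H (X n - g)) \<longlonglongrightarrow> hnorm H (?h - s)"
      using tendsto_add[OF tendsto_const lim] by simp
    have "d \<le> hnorm H (?h - s) + hnorm H (X n - g)" for n
    proof -
      have "d \<le> hnorm H (f - (X n + s))" using XS S_add s d_le by blast
      also have "f - (X n + s) = (?h - s) - (X n - g)" by simp
      also have "hnorm H \<dots> \<le> hnorm H (?h - s) + hnorm H (X n - g)"
        by (rule hnorm_triangle_diff) (use X f g sv in auto)
      finally show ?thesis .
    qed
    then show "\<exists>N. \<forall>n\<ge>N. d \<le> hnorm H (?h - s) + hnorm H (X n - g)" by blast
  qed
  ultimately have min: "hnorm H ?h \<le> hnorm H (?h - s)" if "s \<in> S" for s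
    using that order_trans by blast
  have "ip H ?h s = 0" if s: "s \<in> S" for s
  proof (rule ccontr)
    assume nz: "ip H ?h s \<noteq> 0"
    have sv: "s \<in> vecs H" using s S by blast
    have s0: "s \<noteq> 0" using nz h by auto
    \<comment> \<open>Compare ?h with ?h minus its projection onto s: a nonzero inner product would
      make the norm strictly smaller than the minimum.\<close>
    have "(hnorm H ?h)\<^sup>2 \<le> (hnorm H ?h)\<^sup>2 - (norm (ip H ?h s))\<^sup>2 / (hnorm H s)\<^sup>2"
      unfolding hnorm_diff_projection_power2[OF h sv s0, symmetric]
      by (rule power_mono[OF min[OF S_scale[OF s]] hnorm_nonneg[OF h]])
    then show False using nz s0 sv by (simp add: field_simps)
  qed
  then have "f = g" using orth[OF h] by simp
  with lim XS that show ?thesis by blast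
qed

text \<open>The kernel functions have trivial orthogonal complement, since a vector orthogonal to
  all of them vanishes pointwise. So f is an H1-limit of vectors on which both inner products agree.
  Such a sequence is Cauchy in H2 as well, and its two limits coincide because convergence in either
  norm implies pointwise convergence.\<close>

lemma reproducing_kernel_space_subset:
  fixes H1 H2 :: "('b \<Rightarrow> complex) ip_space"
  assumes H1: "hilbert_space H1" and H2: "hilbert_space H2"
    and z1: "\<And>f z. f \<in> vecs H1 \<Longrightarrow> z \<notin> D \<Longrightarrow> f z = 0"
    and z2: "\<And>f z. f \<in> vecs H2 \<Longrightarrow> z \<notin> D \<Longrightarrow> f z = 0"
    and K1: "\<And>w. w \<in> D \<Longrightarrow> K w \<in> vecs H1" and K2: "\<And>w. w \<in> D \<Longrightarrow> K w \<in> vecs H2"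
    and r1: "\<And>f w. f \<in> vecs H1 \<Longrightarrow> w \<in> D \<Longrightarrow> ip H1 f (K w) = f w"
    and r2: "\<And>f w. f \<in> vecs H2 \<Longrightarrow> w \<in> D \<Longrightarrow> ip H2 f (K w) = f w"
    and f: "f \<in> vecs H1"
  shows "f \<in> vecs H2 \<and> (\<forall>g\<in>vecs H1 \<inter> vecs H2. ip H1 f g = ip H2 f g)"
proof -
  interpret h1: inner_product_space H1 by (rule hilbert_space_imp_inner[OF H1])
  interpret h2: inner_product_space H2 by (rule hilbert_space_imp_inner[OF H2])
  \<comment> \<open>Instead of the span of the kernels, S collects all common vectors whose two
    inner products agree against every common vector. It is closed under linear combinations by
    linearity, and contains each K w because both inner products with K w are evaluation at
    w.\<close>
  define S where "S = {s \<in> vecs H1 \<inter> vecs H2. \<forall>t\<in>vecs H1 \<inter> vecs H2. ip H1 s t = ip H2 s t}"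
  have KS: "K w \<in> S" if "w \<in> D" for w
    using that K1 K2 r1 r2 by (auto simp: S_def h1.ip_commute[of _ "K w"] h2.ip_commute[of _ "K w"])
  obtain X where XS: "\<And>n::nat. X n \<in> S" and lim1: "(\<lambda>n. hnorm H1 (X n - f)) \<longlonglongrightarrow> 0"
  proof (rule hilbert_space_dense_if_orthogonal_trivial[OF H1 _ _ _ _ _ f, of S])
    show "h = 0" if "h \<in> vecs H1" "\<And>s. s \<in> S \<Longrightarrow> ip H1 h s = 0" for h
    proof
      show "h z = 0 z" for z using that KS[of z] r1[of h z] z1[of h z] by (cases "z \<in> D") auto
    qed
  qed (auto simp: S_def h1.ip_add_left h2.ip_add_left h1.ip_scale_left h2.ip_scale_left)
  have X1: "X n \<in> vecs H1" and X2: "X n \<in> vecs H2" for n using XS by (auto simp: S_def)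
  have "hnorm H2 (X i - X k) = hnorm H1 (X i - X k)" for i k
    using XS[of i] XS[of k] by (simp add: hnorm_def S_def h1.ip_diff_left h2.ip_diff_left)
  moreover have "\<exists>N. \<forall>i\<ge>N. \<forall>k\<ge>N. hnorm H1 (X i - X k) < e" if e: "e > 0" for e
  proof -
    obtain N where N: "\<And>n. n \<ge> N \<Longrightarrow> hnorm H1 (X n - f) < e / 2"
      using order_tendstoD(2)[OF lim1, of "e / 2"] e by (auto simp: eventually_sequentially)
    have "hnorm H1 (X i - X k) < e" if "i \<ge> N" "k \<ge> N" for i k
      using h1.hnorm_triangle_diff[of "X i - f" "X k - f"] X1 f N[OF that(1)] N[OF that(2)] by simp
    then show ?thesis by blast
  qed
  ultimately obtain g where g: "g \<in> vecs H2" and lim2: "(\<lambda>n. hnorm H2 (X n - g)) \<longlonglongrightarrow> 0"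
    using hilbert_space_complete[where X = X, OF H2 X2] by auto
  have "f z = g z" for z
  proof (cases "z \<in> D")
    case True
    have "(\<lambda>n. X n z) \<longlonglongrightarrow> f z"
      using h1.tendsto_ip_left[OF X1 f K1[OF True] lim1] by (simp add: r1 X1 f True)
    moreover have "(\<lambda>n. X n z) \<longlonglongrightarrow> g z"
      using h2.tendsto_ip_left[OF X2 g K2[OF True] lim2] by (simp add: r2 X2 g True)
    ultimately show ?thesis by (rule LIMSEQ_unique)
  next
    case False
    then show ?thesis using z1[OF f] z2[OF g] by simp
  qed
  then have fg: "g = f" by auto
  have "ip H1 f t = ip H2 f t" if t: "t \<in> vecs H1 \<inter> vecs H2" for t
  proof (rule LIMSEQ_unique)
    show "(\<lambda>n. ip H1 (X n) t) \<longlonglongrightarrow> ip H1 f t" using h1.tendsto_ip_left[OF X1 f _ lim1] t by simp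
    have "(\<lambda>n. ip H2 (X n) t) \<longlonglongrightarrow> ip H2 f t" using h2.tendsto_ip_left[OF X2 g _ lim2] t fg by simp
    moreover have "ip H2 (X n) t = ip H1 (X n) t" for n using XS t by (simp add: S_def)
    ultimately show "(\<lambda>n. ip H1 (X n) t) \<longlonglongrightarrow> ip H2 f t" by simp
  qed
  with g fg show ?thesis by blast
qed

section \<open>The weighted spaces of power series\<close>

definition coef :: "(complex \<Rightarrow> complex) \<Rightarrow> nat \<Rightarrow> complex"
  where "coef f n = (deriv ^^ n) f 0 / fact n"

definition disc_fun :: "(complex \<Rightarrow> complex) \<Rightarrow> bool"
  where "disc_fun f \<longleftrightarrow> f holomorphic_on unit_disc \<and> (\<forall>z. z \<notin> unit_disc \<longrightarrow> f z = 0)"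

lemma disc_fun_outside: "disc_fun f \<Longrightarrow> z \<notin> unit_disc \<Longrightarrow> f z = 0"
  by (simp add: disc_fun_def)

lemma coef_sums:
  assumes "disc_fun f" "z \<in> unit_disc"
  shows "(\<lambda>n. coef f n * z ^ n) sums f z"
  using holomorphic_power_series[of f 0 1 z] assms by (simp add: coef_def disc_fun_def)

text \<open>Zeros are isolated: a nonzero coefficient would make the sum nonzero on a punctured disc
  around 0.\<close>

lemma powser_sums_zero_imp_zero:
  fixes d :: "nat \<Rightarrow> complex"
  assumes "\<And>z. z \<in> unit_disc \<Longrightarrow> (\<lambda>n. d n * z ^ n) sums 0"
  shows "d n = 0"
proof (rule ccontr)
  assume nz: "d n \<noteq> 0"
  have "d 0 = 0" using sums_unique2[OF assms[of 0] powser_sums_zero] by simp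
  then have "0 < n" using nz by (cases n) auto
  then obtain s where s: "0 < s" "\<And>z. z \<in> cball 0 s - {0::complex} \<Longrightarrow> (0::complex) \<noteq> 0"
    using powser_0_nonzero[of 1 0 d "\<lambda>_. 0" n] assms nz by auto
  from s(2)[of "of_real s"] s(1) show False by simp
qed

text \<open>All later coefficient computations for sums, multiples, kernels, shifts and monomials go
  through this: exhibiting one expansion yields holomorphy and, by uniqueness of expansions, the
  coefficients.\<close>

lemma disc_fun_powser:
  assumes s: "\<And>z. z \<in> unit_disc \<Longrightarrow> (\<lambda>n. b n * z ^ n) sums g z"
    and 0: "\<And>z. z \<notin> unit_disc \<Longrightarrow> g z = 0"
  shows "disc_fun g" and "coef g = b"
proof -
  show g: "disc_fun g"
    unfolding disc_fun_def using power_series_holomorphic[of 0 1 b g] s 0 by simp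
  have "(\<lambda>n. (coef g n - b n) * z ^ n) sums 0" if "z \<in> unit_disc" for z
    using sums_diff[OF coef_sums[OF g that] s[OF that]] by (simp add: algebra_simps)
  from powser_sums_zero_imp_zero[OF this] show "coef g = b" by (simp add: fun_eq_iff)
qed

lemma disc_fun_eqI:
  assumes "disc_fun f" "disc_fun g" "\<And>n. coef f n = coef g n"
  shows "f = g"
proof
  fix z show "f z = g z"
    using coef_sums[OF assms(1), of z] coef_sums[OF assms(2), of z] assms
    by (cases "z \<in> unit_disc") (auto simp: disc_fun_outside sums_iff)
qed

lemma
  assumes f: "disc_fun f" and g: "disc_fun g"
  shows disc_fun_add [simp]: "disc_fun (f + g)"
    and coef_add [simp]: "coef (f + g) n = coef f n + coef g n"
proof -
  have "z \<in> unit_disc \<Longrightarrow> (\<lambda>n. (coef f n + coef g n) * z ^ n) sums (f + g) z" for z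
    using sums_add[OF coef_sums[OF f] coef_sums[OF g]] by (simp add: algebra_simps)
  from disc_fun_powser[where g = "f + g", OF this] show "disc_fun (f + g)"
    "coef (f + g) n = coef f n + coef g n"
    using f g by (auto simp: disc_fun_outside)
qed

lemma
  assumes f: "disc_fun f"
  shows disc_fun_scaleC [simp]: "disc_fun (c *\<^sub>C f)"
    and coef_scaleC [simp]: "coef (c *\<^sub>C f) n = c * coef f n"
proof -
  have "z \<in> unit_disc \<Longrightarrow> (\<lambda>n. (c * coef f n) * z ^ n) sums (c *\<^sub>C f) z" for z
    using sums_mult[OF coef_sums[OF f]]
      by (simp add: algebra_simps scaleC_fun_def scaleC_complex_def)
  from disc_fun_powser[where g = "c *\<^sub>C f", OF this] show "disc_fun (c *\<^sub>C f)"
    "coef (c *\<^sub>C f) n = c * coef f n"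
    using f by (auto simp: disc_fun_outside scaleC_fun_def scaleC_complex_def)
qed

lemma disc_fun_zero [simp]: "disc_fun 0" and coef_zero [simp]: "coef 0 n = 0"
  using disc_fun_powser[of "\<lambda>_. 0" 0] by auto

lemma
  assumes f: "disc_fun f" and g: "disc_fun g"
  shows disc_fun_diff [simp]: "disc_fun (f - g)"
    and coef_diff [simp]: "coef (f - g) n = coef f n - coef g n"
  unfolding diff_eq_scaleC[of f] using f g by simp_all

lemma
  assumes "\<And>i. i \<in> A \<Longrightarrow> disc_fun (f i)"
  shows disc_fun_sum [simp]: "disc_fun (sum f A)"
    and coef_sum [simp]: "coef (sum f A) n = (\<Sum>i\<in>A. coef (f i) n)"
proof -
  have "disc_fun (sum f A) \<and> coef (sum f A) n = (\<Sum>i\<in>A. coef (f i) n)"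
    using assms by (induction A rule: infinite_finite_induct) auto
  then show "disc_fun (sum f A)" "coef (sum f A) n = (\<Sum>i\<in>A. coef (f i) n)" by auto
qed

section \<open>The weights and the completeness of the weighted spaces\<close>

definition wt :: "real \<Rightarrow> nat \<Rightarrow> real"
  where "wt \<alpha> n = pochhammer (2 * \<alpha>) n / fact n"

lemma wt_pos [simp]: "\<alpha> > 0 \<Longrightarrow> 0 < wt \<alpha> n"
  by (simp add: wt_def pochhammer_pos)

lemma wt_nonneg [simp]: "\<alpha> > 0 \<Longrightarrow> 0 \<le> wt \<alpha> n"
  using wt_pos less_imp_le by blast

lemma wt_nonzero [simp]: "\<alpha> > 0 \<Longrightarrow> wt \<alpha> n \<noteq> 0"
  using wt_pos[of \<alpha> n] by linarith

text \<open>The binomial series at -u, its sign turning the binomial coefficient of -2 \<alpha> into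
  a rising factorial. So the weights are the Taylor coefficients of the kernel, and 1 /
  \<open>wt \<alpha> n\<close> will be the squared norm of z^n.\<close>

lemma wt_sums:
  assumes "norm (u::complex) < 1"
  shows "(\<lambda>n. of_real (wt \<alpha> n) * u ^ n) sums ((1 - u) powr of_real (- 2 * \<alpha>))"
proof -
  have "complex_of_real (wt \<alpha> n) = (of_real (- 2 * \<alpha>) gchoose n) * (-1) ^ n" for n
    by (simp add: wt_def gbinomial_pochhammer pochhammer_of_real[symmetric])
  then show ?thesis
    using gen_binomial_complex[of "- u" "of_real (- 2 * \<alpha>)"] assms
    by (simp add: power_minus[of u] mult.assoc)
qed

lemma wt_summable:
  assumes "0 \<le> t" "t < 1"
  shows "summable (\<lambda>n. wt \<alpha> n * t ^ n)"
proof -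
  have "summable (\<lambda>n. complex_of_real (wt \<alpha> n * t ^ n))"
    using wt_sums[of "of_real t" \<alpha>] assms by (simp add: sums_iff)
  then show ?thesis by (simp only: summable_of_real_iff)
qed

text \<open>A concrete model of \<open>disc_space \<alpha>\<close>, which itself is only given by
  choice. It shows that a space with the required kernel exists, and uniqueness then transfers all
  computations to it.\<close>

definition weighted_space :: "real \<Rightarrow> (complex \<Rightarrow> complex) ip_space"
  where "weighted_space \<alpha> =
    \<lparr> vecs = {f. disc_fun f \<and> summable (\<lambda>n. (norm (coef f n))\<^sup>2 / wt \<alpha> n)},
      ip = (\<lambda>f g. \<Sum>n. coef f n * cnj (coef g n) / of_real (wt \<alpha> n)) \<rparr>"

lemma weighted_spaceD:
  assumes "f \<in> vecs (weighted_space \<alpha>)"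
  shows "disc_fun f" "summable (\<lambda>n. (norm (coef f n))\<^sup>2 / wt \<alpha> n)"
  using assms by (auto simp: weighted_space_def)

lemma weighted_spaceI:
  "\<lbrakk>disc_fun f; summable (\<lambda>n. (norm (coef f n))\<^sup>2 / wt \<alpha> n)\<rbrakk> \<Longrightarrow> f \<in> vecs (weighted_space \<alpha>)"
  by (simp add: weighted_space_def)

lemma weighted_ip: "ip (weighted_space \<alpha>) f g = (\<Sum>n. coef f n * cnj (coef g n) / of_real (wt \<alpha> n))"
  by (simp add: weighted_space_def)

lemma Re_weighted_ip_self:
  assumes "f \<in> vecs (weighted_space \<alpha>)"
  shows "Re (ip (weighted_space \<alpha>) f f) = (\<Sum>n. (norm (coef f n))\<^sup>2 / wt \<alpha> n)"
proof -
  have "ip (weighted_space \<alpha>) f f = (\<Sum>n. of_real ((norm (coef f n))\<^sup>2 / wt \<alpha> n))"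
    by (simp add: weighted_ip complex_norm_square[symmetric])
  also have "\<dots> = of_real (\<Sum>n. (norm (coef f n))\<^sup>2 / wt \<alpha> n)"
    by (rule suminf_of_real[symmetric]) (rule weighted_spaceD[OF assms])
  finally show ?thesis by simp
qed

lemma summable_power2_sum:
  fixes a b :: "nat \<Rightarrow> 'a::real_normed_vector"
  assumes "summable (\<lambda>n. (norm (a n))\<^sup>2 / v n)" "summable (\<lambda>n. (norm (b n))\<^sup>2 / v n)"
    and "\<And>n. v n > (0::real)"
  shows "summable (\<lambda>n. (norm (a n + b n))\<^sup>2 / v n)"
proof (rule summable_comparison_test')
  show "summable (\<lambda>n. 2 * ((norm (a n))\<^sup>2 / v n + (norm (b n))\<^sup>2 / v n))"
    by (intro summable_mult summable_add assms)
  fix n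
  have "(norm (a n + b n))\<^sup>2 \<le> (norm (a n) + norm (b n))\<^sup>2"
    by (intro power_mono norm_triangle_ineq) simp
  also have "\<dots> \<le> 2 * ((norm (a n))\<^sup>2 + (norm (b n))\<^sup>2)"
    using sum_squares_bound[of "norm (a n)" "norm (b n)"] by (simp add: power2_sum)
  finally have "(norm (a n + b n))\<^sup>2 / v n \<le> 2 * ((norm (a n))\<^sup>2 + (norm (b n))\<^sup>2) / v n"
    using assms(3)[of n] by (intro divide_right_mono) simp_all
  then show "norm ((norm (a n + b n))\<^sup>2 / v n) \<le> 2 * ((norm (a n))\<^sup>2 / v n + (norm (b n))\<^sup>2 / v n)"
    using assms(3)[of n] by (simp add: add_divide_distrib)
qed

lemma weighted_ip_summable:
  assumes "f \<in> vecs (weighted_space \<alpha>)" "g \<in> vecs (weighted_space \<alpha>)" "\<alpha> > 0"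
  shows "summable (\<lambda>n. coef f n * cnj (coef g n) / of_real (wt \<alpha> n))"
proof (rule summable_comparison_test')
  show "summable (\<lambda>n. (norm (coef f n))\<^sup>2 / wt \<alpha> n + (norm (coef g n))\<^sup>2 / wt \<alpha> n)"
    by (intro summable_add weighted_spaceD assms)
  fix n
  have "norm (coef f n) * norm (coef g n) \<le> (norm (coef f n))\<^sup>2 + (norm (coef g n))\<^sup>2"
    using sum_squares_bound[of "norm (coef f n)" "norm (coef g n)"]
      mult_nonneg_nonneg[OF norm_ge_zero norm_ge_zero, of "coef f n" "coef g n"] by linarith
  then show "norm (coef f n * cnj (coef g n) / of_real (wt \<alpha> n))
      \<le> (norm (coef f n))\<^sup>2 / wt \<alpha> n + (norm (coef g n))\<^sup>2 / wt \<alpha> n"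
    using \<open>\<alpha> > 0\<close> by (simp add: norm_divide norm_mult divide_right_mono flip: add_divide_distrib)
qed

lemma inner_weighted_space:
  assumes "\<alpha> > 0"
  shows "inner_product_space (weighted_space \<alpha>)"
proof
  let ?H = "weighted_space \<alpha>"
  note sm = weighted_ip_summable[OF _ _ assms]
  note D = weighted_spaceD
  show "0 \<in> vecs ?H" by (rule weighted_spaceI) simp_all
  show "f + g \<in> vecs ?H" if "f \<in> vecs ?H" "g \<in> vecs ?H" for f g
    using D[OF that(1)] D[OF that(2)] assms
      by (intro weighted_spaceI) (simp_all add: summable_power2_sum)
  show "c *\<^sub>C f \<in> vecs ?H" if "f \<in> vecs ?H" for f c
    using D[OF that] summable_mult[OF D(2)[OF that], of "(norm c)\<^sup>2"]
    by (intro weighted_spaceI) (simp_all add: norm_mult power_mult_distrib)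
  show "ip ?H (f + g) h = ip ?H f h + ip ?H g h" if "f \<in> vecs ?H" "g \<in> vecs ?H"
    "h \<in> vecs ?H" for f g h
    using suminf_add[OF sm sm, of f h g h] that D(1)
    by (simp add: weighted_ip algebra_simps add_divide_distrib)
  show "ip ?H (c *\<^sub>C f) g = c * ip ?H f g" if "f \<in> vecs ?H" "g \<in> vecs ?H" for f g c
    using suminf_mult[OF sm, of f g c] that D(1) by (simp add: weighted_ip algebra_simps)
  show "ip ?H g f = cnj (ip ?H f g)" if "f \<in> vecs ?H" "g \<in> vecs ?H" for f g
  proof -
    have "(\<lambda>n. cnj (coef f n * cnj (coef g n) / of_real (wt \<alpha> n))) sums cnj (ip ?H f g)"
      unfolding sums_cnj weighted_ip using sm[OF that] by (rule summable_sums)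
    moreover have "(\<lambda>n. cnj (coef f n * cnj (coef g n) / of_real (wt \<alpha> n))) =
        (\<lambda>n. coef g n * cnj (coef f n) / of_real (wt \<alpha> n))"
      by (simp add: mult.commute)
    ultimately show ?thesis unfolding weighted_ip by (simp only: sums_iff)
  qed
  show "0 < Re (ip ?H f f)" if "f \<in> vecs ?H" "f \<noteq> 0" for f
  proof -
    have "\<exists>n. coef f n \<noteq> 0"
      using disc_fun_eqI[OF D(1)[OF that(1)] disc_fun_zero] that(2) by auto
    then obtain n where "coef f n \<noteq> 0" by blast
    then have "0 < (norm (coef f n))\<^sup>2 / wt \<alpha> n" using assms by simp
    then show ?thesis
      unfolding Re_weighted_ip_self[OF that(1)] using assms
      by (intro suminf_pos2[OF D(2)[OF that(1)], of n]) simp_all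
  qed
qed

lemma weighted_hnorm:
  assumes "f \<in> vecs (weighted_space \<alpha>)"
  shows "hnorm (weighted_space \<alpha>) f = sqrt (\<Sum>n. (norm (coef f n))\<^sup>2 / wt \<alpha> n)"
  by (simp add: hnorm_def Re_weighted_ip_self[OF assms])

text \<open>The series converges on the disc because the norm of a n * z^n is at most |a n|^2 / w +
  w |z|^(2n) with w = \<open>wt \<alpha> n\<close>; the second summand is a term of the kernel
  series at |z|^2.\<close>

lemma weighted_powser:
  assumes "\<alpha> > 0" and a: "summable (\<lambda>n. (norm (a n))\<^sup>2 / wt \<alpha> n)"
  obtains f where "f \<in> vecs (weighted_space \<alpha>)" "coef f = a"
proof -
  define f where "f = (\<lambda>z::complex. if z \<in> unit_disc then \<Sum>n. a n * z ^ n else 0)"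
  have s: "(\<lambda>n. a n * z ^ n) sums f z" if z: "z \<in> unit_disc" for z
  proof -
    have "summable (\<lambda>n. a n * z ^ n)"
    proof (rule summable_comparison_test')
      show "summable (\<lambda>n. (norm (a n))\<^sup>2 / wt \<alpha> n + wt \<alpha> n * ((norm z)\<^sup>2) ^ n)"
        using z by (intro summable_add a wt_summable) (simp_all add: power_less_one_iff abs_square_less_1)
      fix n
      let ?w = "wt \<alpha> n" let ?x = "norm (a n)" let ?y = "norm z ^ n"
      have "0 \<le> (?x - ?w * ?y)\<^sup>2 / ?w" using assms by simp
      also have "\<dots> = ?x\<^sup>2 / ?w + ?w * ?y\<^sup>2 - 2 * (?x * ?y)"
        using assms by (simp add: power2_diff field_simps power2_eq_square)
      finally have "2 * (?x * ?y) \<le> ?x\<^sup>2 / ?w + ?w * ?y\<^sup>2" by simp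
      moreover have "0 \<le> ?x * ?y" by simp
      ultimately show "norm (a n * z ^ n) \<le> ?x\<^sup>2 / ?w + ?w * ((norm z)\<^sup>2) ^ n"
        unfolding norm_mult norm_power power_mult[symmetric] mult.commute[of 2 n] by linarith
    qed
    then show ?thesis using z by (simp add: f_def summable_sums)
  qed
  have 0: "f z = 0" if "z \<notin> unit_disc" for z using that by (simp add: f_def)
  have "disc_fun f" "coef f = a"
    using disc_fun_powser[OF s 0] by auto
  with a that show thesis by (metis weighted_spaceI)
qed

text \<open>Completeness as for square-summable sequences: coefficients of a Cauchy sequence
  converge one by one, and bounds on finite partial sums show that the limits form a vector of the
  space and that convergence is in norm.\<close>

lemma hilbert_weighted_space:
  assumes "\<alpha> > 0"
  shows "hilbert_space (weighted_space \<alpha>)"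
proof -
  let ?H = "weighted_space \<alpha>"
  interpret inner_product_space ?H by (rule inner_weighted_space[OF assms])
  have "\<exists>f\<in>vecs ?H. (\<lambda>n. hnorm ?H (X n - f)) \<longlonglongrightarrow> 0"
    if X: "\<And>n. X n \<in> vecs ?H" and cau: "\<And>e. e > 0 \<Longrightarrow> \<exists>N. \<forall>i\<ge>N. \<forall>k\<ge>N. hnorm ?H (X i - X k) < e"
    for X :: "nat \<Rightarrow> complex \<Rightarrow> complex"
  proof -
    have partial_le: "(\<Sum>p<P. (norm (coef f p))\<^sup>2 / wt \<alpha> p) \<le> (hnorm ?H f)\<^sup>2"
      if "f \<in> vecs ?H" for f P
      unfolding hnorm_power2[OF that] Re_weighted_ip_self[OF that]
      using weighted_spaceD[OF that] assms by (intro sum_le_suminf) auto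
    have "\<exists>l. (\<lambda>n. coef (X n) p) \<longlonglongrightarrow> l" for p
    proof -
      have "Cauchy (\<lambda>n. coef (X n) p)"
      proof (rule metric_CauchyI)
        fix e :: real assume e: "e > 0"
        obtain N where N: "\<And>i k. i \<ge> N \<Longrightarrow> k \<ge> N \<Longrightarrow> hnorm ?H (X i - X k) < e / sqrt (wt \<alpha> p)"
          using cau[of "e / sqrt (wt \<alpha> p)"] e assms by auto
        have "dist (coef (X i) p) (coef (X k) p) < e" if ik: "i \<ge> N" "k \<ge> N" for i k
        proof (rule power2_less_imp_less)
          have XX: "X i - X k \<in> vecs ?H" using X by simp
          have "(norm (coef (X i - X k) p))\<^sup>2 / wt \<alpha> p
              \<le> (\<Sum>p<Suc p. (norm (coef (X i - X k) p))\<^sup>2 / wt \<alpha> p)"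
            using assms by (simp add: sum_nonneg)
          also have "\<dots> \<le> (hnorm ?H (X i - X k))\<^sup>2" by (rule partial_le[OF XX])
          also have "\<dots> < (e / sqrt (wt \<alpha> p))\<^sup>2"
            using N[OF ik] XX by (intro power_strict_mono) simp_all
          also have "\<dots> = e\<^sup>2 / wt \<alpha> p" using assms by (simp add: power_divide)
          finally have "(norm (coef (X i - X k) p))\<^sup>2 < e\<^sup>2"
            using wt_pos[OF assms, of p] by (simp add: divide_less_cancel)
          then show "(dist (coef (X i) p) (coef (X k) p))\<^sup>2 < e\<^sup>2"
            using weighted_spaceD(1)[OF X] by (simp add: dist_norm)
        qed (use e in simp)
        then show "\<exists>N. \<forall>i\<ge>N. \<forall>k\<ge>N. dist (coef (X i) p) (coef (X k) p) < e" by blast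
      qed
      then show ?thesis by (simp add: Cauchy_convergent_iff convergent_def)
    qed
    then obtain a where a: "\<And>p. (\<lambda>n. coef (X n) p) \<longlonglongrightarrow> a p" by metis
    \<comment> \<open>For finitely many coefficients k may tend to infinity in the Cauchy estimate;
      the resulting bound does not depend on P.\<close>
    have tail: "(\<Sum>p<P. (norm (coef (X i) p - a p))\<^sup>2 / wt \<alpha> p) \<le> e\<^sup>2"
      if N: "\<And>i k. i \<ge> N \<Longrightarrow> k \<ge> N \<Longrightarrow> hnorm ?H (X i - X k) < e" and i: "i \<ge> N" for N e i P
    proof (rule LIMSEQ_le_const2)
      show "(\<lambda>k. \<Sum>p<P. (norm (coef (X i) p - coef (X k) p))\<^sup>2 / wt \<alpha> p)
          \<longlonglongrightarrow> (\<Sum>p<P. (norm (coef (X i) p - a p))\<^sup>2 / wt \<alpha> p)"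
        using assms by (intro tendsto_intros a) simp
      have "(\<Sum>p<P. (norm (coef (X i) p - coef (X k) p))\<^sup>2 / wt \<alpha> p) \<le> e\<^sup>2" if k: "k \<ge> N" for k
      proof -
        have XX: "X i - X k \<in> vecs ?H" using X by simp
        have "(\<Sum>p<P. (norm (coef (X i - X k) p))\<^sup>2 / wt \<alpha> p) \<le> (hnorm ?H (X i - X k))\<^sup>2"
          by (rule partial_le[OF XX])
        also have "\<dots> \<le> e\<^sup>2" using N[OF i k] XX by (intro power_mono) simp_all
        finally show ?thesis using weighted_spaceD(1)[OF X] by simp
      qed
      then show "\<exists>M. \<forall>k\<ge>M. (\<Sum>p<P. (norm (coef (X i) p - coef (X k) p))\<^sup>2 / wt \<alpha> p) \<le> e\<^sup>2" by blast
    qed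
    have summ: "summable (\<lambda>p. (norm (coef (X i) p - a p))\<^sup>2 / wt \<alpha> p)"
      if "\<And>i k. i \<ge> N \<Longrightarrow> k \<ge> N \<Longrightarrow> hnorm ?H (X i - X k) < e" "i \<ge> N" for N e i
      using tail[OF that] assms
      by (intro bounded_imp_summable[of _ "e\<^sup>2"]) (simp_all only: lessThan_Suc_atMost[symmetric], simp)
    obtain N1 where N1: "\<And>i k. i \<ge> N1 \<Longrightarrow> k \<ge> N1 \<Longrightarrow> hnorm ?H (X i - X k) < 1"
      using cau[of 1] by auto
    \<comment> \<open>The limit sequence is its difference from X N1, square-summable by the Cauchy
      estimate with bound 1, plus the coefficients of X N1.\<close>
    have "summable (\<lambda>p. (norm ((a p - coef (X N1) p) + coef (X N1) p))\<^sup>2 / wt \<alpha> p)"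
      using summ[OF N1 order_refl] weighted_spaceD(2)[OF X] assms
      by (intro summable_power2_sum) (simp_all add: norm_minus_commute)
    then obtain f where f: "f \<in> vecs ?H" and fa: "coef f = a"
      using weighted_powser[OF assms, of a] by auto
    have "(\<lambda>n. hnorm ?H (X n - f)) \<longlonglongrightarrow> 0"
    proof (rule LIMSEQ_I)
      fix e :: real assume e: "e > 0"
      then obtain N where N: "\<And>i k. i \<ge> N \<Longrightarrow> k \<ge> N \<Longrightarrow> hnorm ?H (X i - X k) < e / 2"
        using cau[of "e / 2"] by auto
      have "norm (hnorm ?H (X i - f) - 0) < e" if i: "i \<ge> N" for i
      proof -
        have Xf: "X i - f \<in> vecs ?H" using X f by simp
        have co: "coef (X i - f) p = coef (X i) p - a p" for p
          using weighted_spaceD(1)[OF X] weighted_spaceD(1)[OF f] fa by simp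
        have "(hnorm ?H (X i - f))\<^sup>2 \<le> (e / 2)\<^sup>2"
          unfolding hnorm_power2[OF Xf] Re_weighted_ip_self[OF Xf] co
          by (rule suminf_le_const[OF summ[OF N i] tail[OF N i]])
        then have "hnorm ?H (X i - f) \<le> e / 2" by (rule power2_le_imp_le) (use e in simp)
        then show ?thesis using e Xf by simp
      qed
      then show "\<exists>no. \<forall>n\<ge>no. norm (hnorm ?H (X n - f) - 0) < e" by blast
    qed
    with f show ?thesis by blast
  qed
  then show ?thesis
    unfolding hilbert_space_def
    by (intro conjI ballI allI impI)
      (simp_all add: ip_add_left ip_scale_left ip_pos, erule ip_commute)
qed

section \<open>The kernel functions and the identification with \<open>disc_space\<close>\<close>

lemma
  assumes "\<alpha> > 0" and w: "w \<in> unit_disc"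
  shows coef_disc_kernel: "coef (disc_kernel \<alpha> w) n = of_real (wt \<alpha> n) * cnj w ^ n"
    and disc_kernel_mem: "disc_kernel \<alpha> w \<in> vecs (weighted_space \<alpha>)"
proof -
  have s: "(\<lambda>n. (of_real (wt \<alpha> n) * cnj w ^ n) * z ^ n) sums disc_kernel \<alpha> w z"
    if z: "z \<in> unit_disc" for z
  proof -
    have "norm (z * cnj w) < 1"
      using mult_strict_mono'[of "norm z" 1 "norm w" 1] w z by (simp add: norm_mult)
    from wt_sums[OF this, of \<alpha>] show ?thesis
      using z by (simp add: disc_kernel_def power_mult_distrib mult_ac)
  qed
  have 0: "disc_kernel \<alpha> w z = 0" if "z \<notin> unit_disc" for z using that by (simp add: disc_kernel_def)
  note P = disc_fun_powser[OF s 0]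
  show co: "coef (disc_kernel \<alpha> w) n = of_real (wt \<alpha> n) * cnj w ^ n" for n
    using P(2) by (simp add: fun_eq_iff)
  have "(norm (coef (disc_kernel \<alpha> w) n))\<^sup>2 / wt \<alpha> n = wt \<alpha> n * ((norm w)\<^sup>2) ^ n" for n
    using assms by (simp add: co norm_mult norm_power power_mult_distrib power2_eq_square)
  then show "disc_kernel \<alpha> w \<in> vecs (weighted_space \<alpha>)"
    using P(1) w wt_summable[of "(norm w)\<^sup>2" \<alpha>]
    by (intro weighted_spaceI) (simp_all add: abs_square_less_1)
qed

text \<open>The weight in the coefficients of the kernel cancels the weight in the inner product,
  which leaves the Taylor series of f at w.\<close>

lemma weighted_reproducing:
  assumes "\<alpha> > 0" "w \<in> unit_disc" "f \<in> vecs (weighted_space \<alpha>)"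
  shows "ip (weighted_space \<alpha>) f (disc_kernel \<alpha> w) = f w"
  using coef_sums[OF weighted_spaceD(1)[OF assms(3)] assms(2)] assms
  by (simp add: weighted_ip coef_disc_kernel sums_iff)

lemma is_disc_space_weighted_space: "\<alpha> > 0 \<Longrightarrow> is_disc_space \<alpha> (weighted_space \<alpha>)"
  using hilbert_weighted_space weighted_spaceD(1) disc_kernel_mem weighted_reproducing
  by (auto simp: is_disc_space_def disc_fun_def)

lemma is_disc_space_unique:
  assumes "is_disc_space \<alpha> H1" "is_disc_space \<alpha> H2"
  shows "vecs H1 = vecs H2" and "f \<in> vecs H1 \<Longrightarrow> g \<in> vecs H1 \<Longrightarrow> ip H1 f g = ip H2 f g"
proof -
  have *: "f \<in> vecs K2 \<and> (\<forall>g\<in>vecs K1 \<inter> vecs K2. ip K1 f g = ip K2 f g)"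
    if "is_disc_space \<alpha> K1" "is_disc_space \<alpha> K2" "f \<in> vecs K1" for K1 K2 f
    by (rule reproducing_kernel_space_subset[where D = unit_disc and K = "disc_kernel \<alpha>"])
      (use that in \<open>simp_all add: is_disc_space_def\<close>)
  show "vecs H1 = vecs H2" using *[OF assms] *[OF assms(2,1)] by blast
  then show "f \<in> vecs H1 \<Longrightarrow> g \<in> vecs H1 \<Longrightarrow> ip H1 f g = ip H2 f g" using *[OF assms] by blast
qed

text \<open>The arbitrary choice in \<open>disc_space\<close> becomes harmless here. Inner products
  are compared on the carrier only, since off it the chosen space is unspecified.\<close>

lemma
  assumes "\<alpha> > 0"
  shows vecs_disc_space: "vecs (disc_space \<alpha>) = vecs (weighted_space \<alpha>)"
    and ip_disc_space: "\<lbrakk>f \<in> vecs (weighted_space \<alpha>); g \<in> vecs (weighted_space \<alpha>)\<rbrakk>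
      \<Longrightarrow> ip (disc_space \<alpha>) f g = ip (weighted_space \<alpha>) f g"
proof -
  have W: "is_disc_space \<alpha> (weighted_space \<alpha>)" by (rule is_disc_space_weighted_space[OF assms])
  then have D: "is_disc_space \<alpha> (disc_space \<alpha>)" unfolding disc_space_def by (rule someI)
  from is_disc_space_unique[OF D W]
  show "vecs (disc_space \<alpha>) = vecs (weighted_space \<alpha>)"
    "\<lbrakk>f \<in> vecs (weighted_space \<alpha>); g \<in> vecs (weighted_space \<alpha>)\<rbrakk>
      \<Longrightarrow> ip (disc_space \<alpha>) f g = ip (weighted_space \<alpha>) f g" by auto
qed

section \<open>Differentiation and multiplication by the coordinate\<close>

lemma wt_Suc: "wt \<alpha> (Suc n) = wt \<alpha> n * ((2 * \<alpha> + n) / (n + 1))"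
  by (simp add: wt_def pochhammer_Suc)

text \<open>Compares z^(n+1) for \<alpha> with z^n, the power in its derivative, for \<alpha> + 1.
  The factor decays like 1 / n^2, which offsets the square of n + 1 produced by differentiation and
  later makes component 0 dominant.\<close>

lemma wt_Suc_shift:
  assumes "\<alpha> > 0"
  shows "wt \<alpha> (Suc n) = wt (\<alpha> + 1) n * (2 * \<alpha> * (2 * \<alpha> + 1) / ((n + 1) * (2 * \<alpha> + n + 1)))"
proof -
  have "pochhammer (2 * \<alpha>) (Suc (Suc n)) = 2 * \<alpha> * (2 * \<alpha> + 1) * pochhammer (2 * (\<alpha> + 1)) n"
    by (simp add: pochhammer_rec[of _ "Suc n"] pochhammer_rec[of _ n] algebra_simps)
  then have "pochhammer (2 * \<alpha>) (Suc n) = 2 * \<alpha> * (2 * \<alpha> + 1) * pochhammer (2 * (\<alpha> + 1)) n / (2 * \<alpha> + n + 1)"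
    using assms by (simp add: pochhammer_Suc[of _ "Suc n"] field_simps)
  then show ?thesis by (simp add: wt_def mult_ac add_ac)
qed

text \<open>Partial sums are compared instead of single terms because differentiation and
  multiplication by z shift the index.\<close>

lemma summable_dominated:
  fixes F G :: "nat \<Rightarrow> real"
  assumes F: "summable F" "\<And>n. 0 \<le> F n" and G: "\<And>n. 0 \<le> G n" and "0 \<le> C"
    and le: "\<And>N. \<exists>M. (\<Sum>n<N. G n) \<le> C * (\<Sum>n<M. F n)"
  shows "summable G" and "suminf G \<le> C * suminf F"
proof -
  have b: "(\<Sum>n<N. G n) \<le> C * suminf F" for N
  proof -
    obtain M where "(\<Sum>n<N. G n) \<le> C * (\<Sum>n<M. F n)" using le by blast
    also have "\<dots> \<le> C * suminf F"
      using F \<open>0 \<le> C\<close> by (intro mult_left_mono sum_le_suminf) auto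
    finally show ?thesis .
  qed
  show "summable G"
    using b[of "Suc n" for n] G
      by (intro bounded_imp_summable[of _ "C * suminf F"]) (simp_all only: lessThan_Suc_atMost)
  then show "suminf G \<le> C * suminf F" by (rule suminf_le_const) (rule b)
qed

lemma weighted_space_dominated:
  assumes "\<alpha> > 0" "\<beta> > 0" and f: "f \<in> vecs (weighted_space \<alpha>)" and g: "disc_fun g" and "0 \<le> C"
    and le: "\<And>N. \<exists>M. (\<Sum>n<N. (norm (coef g n))\<^sup>2 / wt \<beta> n) \<le> C * (\<Sum>n<M. (norm (coef f n))\<^sup>2 / wt \<alpha> n)"
  shows "g \<in> vecs (weighted_space \<beta>)"
    and "hnorm (weighted_space \<beta>) g \<le> sqrt C * hnorm (weighted_space \<alpha>) f"
proof -
  note D = summable_dominated[OF weighted_spaceD(2)[OF f] _ _ \<open>0 \<le> C\<close> le]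
  show g': "g \<in> vecs (weighted_space \<beta>)"
    using assms by (intro weighted_spaceI g D(1)) simp_all
  show "hnorm (weighted_space \<beta>) g \<le> sqrt C * hnorm (weighted_space \<alpha>) f"
    unfolding weighted_hnorm[OF f] weighted_hnorm[OF g'] real_sqrt_mult[symmetric]
    using assms by (intro real_sqrt_le_mono D(2)) simp_all
qed

text \<open>The cutoff keeps derivatives among the functions vanishing off the disc and matches the
  one in \<open>Gam\<close>.\<close>

definition disc_deriv :: "nat \<Rightarrow> (complex \<Rightarrow> complex) \<Rightarrow> complex \<Rightarrow> complex"
  where "disc_deriv k f = (\<lambda>z. if z \<in> unit_disc then (deriv ^^ k) f z else 0)"

lemma disc_fun_disc_deriv [simp]: "disc_fun f \<Longrightarrow> disc_fun (disc_deriv k f)"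
proof -
  assume "disc_fun f"
  then have "(deriv ^^ k) f holomorphic_on unit_disc"
    by (simp add: disc_fun_def holomorphic_higher_deriv)
  then have "disc_deriv k f holomorphic_on unit_disc"
    by (rule holomorphic_transform) (simp add: disc_deriv_def)
  then show ?thesis by (simp add: disc_fun_def disc_deriv_def)
qed

lemma coef_disc_deriv [simp]:
  assumes "disc_fun f"
  shows "coef (disc_deriv k f) n = fact (n + k) / fact n * coef f (n + k)"
proof -
  have "(deriv ^^ n) (disc_deriv k f) 0 = (deriv ^^ n) ((deriv ^^ k) f) 0"
  proof (rule higher_deriv_transform_within_open[of _ unit_disc])
    show "disc_deriv k f holomorphic_on unit_disc"
      using disc_fun_disc_deriv[OF assms] by (simp add: disc_fun_def)
    show "(deriv ^^ k) f holomorphic_on unit_disc"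
      using assms by (simp add: disc_fun_def holomorphic_higher_deriv)
  qed (simp_all add: disc_deriv_def)
  then show ?thesis by (simp add: coef_def funpow_add)
qed

lemma disc_deriv_0 [simp]: "disc_fun f \<Longrightarrow> disc_deriv 0 f = f"
  by (auto simp: disc_deriv_def disc_fun_outside)

lemma disc_deriv_Suc: "disc_fun f \<Longrightarrow> disc_deriv (Suc k) f = disc_deriv 1 (disc_deriv k f)"
  by (intro disc_fun_eqI) (simp_all del: fact_Suc)

lemma disc_deriv_add: "\<lbrakk>disc_fun f; disc_fun g\<rbrakk> \<Longrightarrow> disc_deriv k (f + g) = disc_deriv k f + disc_deriv k g"
  by (intro disc_fun_eqI) (simp_all add: algebra_simps)

lemma disc_deriv_scaleC: "disc_fun f \<Longrightarrow> disc_deriv k (c *\<^sub>C f) = c *\<^sub>C disc_deriv k f"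
  by (intro disc_fun_eqI) (simp_all add: algebra_simps)

lemma disc_deriv_zero [simp]: "disc_deriv k 0 = 0"
  by (intro disc_fun_eqI) simp_all

lemma disc_deriv_1_bound:
  assumes "\<alpha> > 0" and f: "f \<in> vecs (weighted_space \<alpha>)"
  shows "disc_deriv 1 f \<in> vecs (weighted_space (\<alpha> + 1))"
    and "hnorm (weighted_space (\<alpha> + 1)) (disc_deriv 1 f) \<le> sqrt (2 * \<alpha> * (2 * \<alpha> + 1)) * hnorm (weighted_space \<alpha>) f"
proof -
  let ?C = "2 * \<alpha> * (2 * \<alpha> + 1)"
  let ?F = "\<lambda>n. (norm (coef f n))\<^sup>2 / wt \<alpha> n"
  have step: "(norm (coef (disc_deriv 1 f) n))\<^sup>2 / wt (\<alpha> + 1) n \<le> ?C * ?F (Suc n)" for n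
  proof -
    have "(norm (coef (disc_deriv 1 f) n))\<^sup>2 / wt (\<alpha> + 1) n
        = (real n + 1)\<^sup>2 * (norm (coef f (Suc n)))\<^sup>2 / wt (\<alpha> + 1) n"
      using weighted_spaceD(1)[OF f] norm_of_nat[of "Suc n", where 'a = complex]
      by (simp add: norm_mult power_mult_distrib del: norm_of_nat)
    also have "\<dots> = (real n + 1) / (2 * \<alpha> + n + 1) * (?C * ?F (Suc n))"
      unfolding wt_Suc_shift[OF \<open>\<alpha> > 0\<close>] using \<open>\<alpha> > 0\<close> wt_pos[of "\<alpha> + 1" n]
      by (simp add: divide_simps power2_eq_square add_pos_pos)
    also have "\<dots> \<le> 1 * (?C * ?F (Suc n))"
      using \<open>\<alpha> > 0\<close> by (intro mult_right_mono) simp_all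
    finally show ?thesis by simp
  qed
  have le: "\<exists>M. (\<Sum>n<N. (norm (coef (disc_deriv 1 f) n))\<^sup>2 / wt (\<alpha> + 1) n) \<le> ?C * (\<Sum>n<M. ?F n)" for N
  proof
    have "(\<Sum>n<N. (norm (coef (disc_deriv 1 f) n))\<^sup>2 / wt (\<alpha> + 1) n) \<le> (\<Sum>n<N. ?C * ?F (Suc n))"
      by (intro sum_mono step)
    also have "\<dots> \<le> ?C * (\<Sum>n<Suc N. ?F n)"
      unfolding sum.lessThan_Suc_shift sum_distrib_left[symmetric]
      using \<open>\<alpha> > 0\<close> by (intro mult_left_mono) simp_all
    finally show "(\<Sum>n<N. (norm (coef (disc_deriv 1 f) n))\<^sup>2 / wt (\<alpha> + 1) n) \<le> ?C * (\<Sum>n<Suc N. ?F n)" .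
  qed
  have pos: "\<alpha> + 1 > 0" "0 \<le> ?C" using \<open>\<alpha> > 0\<close> by simp_all
  show "disc_deriv 1 f \<in> vecs (weighted_space (\<alpha> + 1))"
    and "hnorm (weighted_space (\<alpha> + 1)) (disc_deriv 1 f) \<le> sqrt ?C * hnorm (weighted_space \<alpha>) f"
    by (rule weighted_space_dominated[OF \<open>\<alpha> > 0\<close> pos(1) f disc_fun_disc_deriv[OF weighted_spaceD(1)[OF f]] pos(2) le])+
qed

text \<open>Each derivative raises the parameter by one. As \<open>lamj m la j\<close> also grows by
  one with j, the (l - j)-th derivative maps the j-th space boundedly into the l-th.\<close>

lemma disc_deriv_bounded:
  assumes "\<alpha> > 0"
  shows "\<exists>C\<ge>0. \<forall>f\<in>vecs (weighted_space \<alpha>). disc_deriv k f \<in> vecs (weighted_space (\<alpha> + k)) \<and>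
    hnorm (weighted_space (\<alpha> + k)) (disc_deriv k f) \<le> C * hnorm (weighted_space \<alpha>) f"
proof (induction k)
  case 0
  show ?case using weighted_spaceD(1) by (intro exI[of _ 1]) auto
next
  case (Suc k)
  then obtain C where C: "C \<ge> 0"
    "\<And>f. f \<in> vecs (weighted_space \<alpha>) \<Longrightarrow> disc_deriv k f \<in> vecs (weighted_space (\<alpha> + k))"
    "\<And>f. f \<in> vecs (weighted_space \<alpha>) \<Longrightarrow> hnorm (weighted_space (\<alpha> + k)) (disc_deriv k f) \<le> C * hnorm (weighted_space \<alpha>) f"
    by blast
  define D where "D = sqrt (2 * (\<alpha> + k) * (2 * (\<alpha> + k) + 1))"
  have D: "D \<ge> 0" using assms by (simp add: D_def)
  have "disc_deriv (Suc k) f \<in> vecs (weighted_space (\<alpha> + Suc k)) \<and>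
      hnorm (weighted_space (\<alpha> + Suc k)) (disc_deriv (Suc k) f) \<le> (D * C) * hnorm (weighted_space \<alpha>) f"
    if f: "f \<in> vecs (weighted_space \<alpha>)" for f
  proof -
    have "hnorm (weighted_space (\<alpha> + k + 1)) (disc_deriv 1 (disc_deriv k f)) \<le> D * hnorm (weighted_space (\<alpha> + k)) (disc_deriv k f)"
      unfolding D_def using assms by (intro disc_deriv_1_bound C(2) f) simp
    also have "\<dots> \<le> D * (C * hnorm (weighted_space \<alpha>) f)"
      by (intro mult_left_mono C(3) f D)
    finally show ?thesis
      using disc_deriv_1_bound(1)[OF _ C(2)[OF f]] assms weighted_spaceD(1)[OF f]
      by (simp add: disc_deriv_Suc[of f k] add.assoc mult.assoc add.commute[of 1])
  qed
  with D C(1) show ?case by (intro exI[of _ "D * C"]) simp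
qed

section \<open>Multiplication and division by z in one weighted space\<close>

definition zmult :: "(complex \<Rightarrow> complex) \<Rightarrow> complex \<Rightarrow> complex"
  where "zmult f = (\<lambda>z. z * f z)"

lemma
  assumes f: "disc_fun f"
  shows disc_fun_zmult [simp]: "disc_fun (zmult f)"
    and coef_zmult_0 [simp]: "coef (zmult f) 0 = 0"
    and coef_zmult_Suc [simp]: "coef (zmult f) (Suc n) = coef f n"
proof -
  let ?b = "\<lambda>n. case n of 0 \<Rightarrow> 0 | Suc k \<Rightarrow> coef f k"
  have s: "(\<lambda>n. ?b n * z ^ n) sums zmult f z" if "z \<in> unit_disc" for z
  proof -
    have "(\<lambda>n. ?b (Suc n) * z ^ Suc n) sums zmult f z"
      using sums_mult[OF coef_sums[OF f that], of z] by (simp add: zmult_def algebra_simps)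
    then show ?thesis by (subst (asm) sums_Suc_iff) simp
  qed
  have 0: "zmult f z = 0" if "z \<notin> unit_disc" for z
    using disc_fun_outside[OF f that] by (simp add: zmult_def)
  note P = disc_fun_powser[of ?b "zmult f", OF s 0]
  show "disc_fun (zmult f)" using P(1) .
  show "coef (zmult f) 0 = 0" "coef (zmult f) (Suc n) = coef f n"
    using P(2) by (simp_all add: fun_eq_iff)
qed

lemma zmult_zero [simp]: "zmult 0 = 0"
  and zmult_add: "zmult (f + g) = zmult f + zmult g"
  and zmult_scaleC: "zmult (c *\<^sub>C f) = c *\<^sub>C zmult f"
  by (simp_all add: zmult_def fun_eq_iff scaleC_fun_def scaleC_complex_def algebra_simps)

text \<open>The squared norm of z^(n+1) is (n + 1) / (2 \<alpha> + n) times that of z^n, and 1 + 1 /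
  (2 \<alpha>) bounds this for all n.\<close>

lemma zmult_bound:
  assumes "\<alpha> > 0" and f: "f \<in> vecs (weighted_space \<alpha>)"
  shows "zmult f \<in> vecs (weighted_space \<alpha>)"
    and "hnorm (weighted_space \<alpha>) (zmult f) \<le> sqrt (1 + 1 / (2 * \<alpha>)) * hnorm (weighted_space \<alpha>) f"
proof -
  let ?C = "1 + 1 / (2 * \<alpha>)"
  note f' = weighted_spaceD(1)[OF f]
  let ?F = "\<lambda>n. (norm (coef f n))\<^sup>2 / wt \<alpha> n"
  let ?G = "\<lambda>n. (norm (coef (zmult f) n))\<^sup>2 / wt \<alpha> n"
  have step: "?G (Suc n) \<le> ?C * ?F n" for n
  proof -
    have "?G (Suc n) = (real n + 1) / (2 * \<alpha> + n) * ?F n"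
      using f' \<open>\<alpha> > 0\<close> by (simp add: wt_Suc add_pos_nonneg field_simps)
    also have "\<dots> \<le> ?C * ?F n"
      using \<open>\<alpha> > 0\<close> by (intro mult_right_mono) (simp_all add: field_simps add_pos_nonneg)
    finally show ?thesis .
  qed
  have le: "\<exists>M. (\<Sum>n<N. ?G n) \<le> ?C * (\<Sum>n<M. ?F n)" for N
  proof
    have "(\<Sum>n<N. ?G n) \<le> (\<Sum>n<Suc N. ?G n)" using \<open>\<alpha> > 0\<close> by simp
    also have "\<dots> = (\<Sum>n<N. ?G (Suc n))" unfolding sum.lessThan_Suc_shift using f' by simp
    also have "\<dots> \<le> (\<Sum>n<N. ?C * ?F n)" by (intro sum_mono step)
    finally show "(\<Sum>n<N. ?G n) \<le> ?C * (\<Sum>n<N. ?F n)" by (simp only: sum_distrib_left)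
  qed
  show "zmult f \<in> vecs (weighted_space \<alpha>)"
    and "hnorm (weighted_space \<alpha>) (zmult f) \<le> sqrt ?C * hnorm (weighted_space \<alpha>) f"
    by (rule weighted_space_dominated[OF _ _ f _ _ le], use \<open>\<alpha> > 0\<close> f' in simp_all)+
qed

text \<open>Shift the coefficients down by one; the inverse ratio (2 \<alpha> + n) / (n + 1) is at
  most 2 \<alpha> + 1, so the shifted sequence stays square-summable.\<close>

lemma zmult_division:
  assumes "\<alpha> > 0" and f: "f \<in> vecs (weighted_space \<alpha>)" and "coef f 0 = 0"
  obtains g where "g \<in> vecs (weighted_space \<alpha>)" "f = zmult g"
proof -
  note f' = weighted_spaceD(1)[OF f]
  have "summable (\<lambda>n. (norm (coef f (Suc n)))\<^sup>2 / wt \<alpha> n)"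
  proof (rule summable_comparison_test')
    show "summable (\<lambda>n. (2 * \<alpha> + 1) * ((norm (coef f (Suc n)))\<^sup>2 / wt \<alpha> (Suc n)))"
      using weighted_spaceD(2)[OF f] summable_Suc_iff[of "\<lambda>n. (norm (coef f n))\<^sup>2 / wt \<alpha> n"]
      by (intro summable_mult) simp
    fix n
    have "(norm (coef f (Suc n)))\<^sup>2 / wt \<alpha> n = (2 * \<alpha> + n) / (n + 1) * ((norm (coef f (Suc n)))\<^sup>2 / wt \<alpha> (Suc n))"
    proof -
      have "x / w = q * (x / (w * q))" if "q > 0" for x w q :: real using that by simp
      moreover have "0 < (2 * \<alpha> + n) / (n + 1)" using \<open>\<alpha> > 0\<close> by (simp add: add_pos_nonneg)
      ultimately show ?thesis unfolding wt_Suc .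
    qed
    also have "\<dots> \<le> (2 * \<alpha> + 1) * ((norm (coef f (Suc n)))\<^sup>2 / wt \<alpha> (Suc n))"
      using \<open>\<alpha> > 0\<close> by (intro mult_right_mono) (simp_all add: field_simps)
    finally show "norm ((norm (coef f (Suc n)))\<^sup>2 / wt \<alpha> n) \<le> (2 * \<alpha> + 1) * ((norm (coef f (Suc n)))\<^sup>2 / wt \<alpha> (Suc n))"
      using \<open>\<alpha> > 0\<close> by simp
  qed
  from weighted_powser[OF \<open>\<alpha> > 0\<close> this]
  obtain g where g: "g \<in> vecs (weighted_space \<alpha>)" "coef g = (\<lambda>n. coef f (Suc n))" .
  have "coef f n = coef (zmult g) n" for n
    using g weighted_spaceD(1)[OF g(1)] assms(3) by (cases n) simp_all
  then have "f = zmult g" using f' weighted_spaceD(1)[OF g(1)] by (intro disc_fun_eqI) simp_all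
  with g that show thesis by blast
qed

section \<open>Monomials\<close>

definition mon :: "nat \<Rightarrow> complex \<Rightarrow> complex"
  where "mon n = (\<lambda>z. if z \<in> unit_disc then z ^ n else 0)"

lemma
  shows disc_fun_mon [simp]: "disc_fun (mon n)"
    and coef_mon: "coef (mon n) k = (if k = n then 1 else 0)"
proof -
  have s: "(\<lambda>k. (if k = n then 1 else 0) * z ^ k) sums mon n z" if "z \<in> unit_disc" for z
    using sums_single[of n "\<lambda>k. z ^ k"] that
      by (simp add: mon_def if_distrib[of "\<lambda>x. x * _"] cong: if_cong)
  have 0: "mon n z = 0" if "z \<notin> unit_disc" for z using that by (simp add: mon_def)
  from disc_fun_powser[OF s 0] show "disc_fun (mon n)" "coef (mon n) k = (if k = n then 1 else 0)"
    by auto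
qed

lemma mon_mem: "\<alpha> > 0 \<Longrightarrow> mon n \<in> vecs (weighted_space \<alpha>)"
  by (intro weighted_spaceI summable_finite[of "{n}"]) (simp_all add: coef_mon)

lemma ip_mon: "ip (weighted_space \<alpha>) f (mon n) = coef f n / of_real (wt \<alpha> n)"
proof -
  have "(\<lambda>k. coef f k * cnj (coef (mon n) k) / of_real (wt \<alpha> k)) = (\<lambda>k. if k = n then coef f k / of_real (wt \<alpha> k) else 0)"
    by (auto simp: coef_mon)
  then show ?thesis
    using sums_single[of n "\<lambda>k. coef f k / of_real (wt \<alpha> k)"] by (simp add: weighted_ip sums_iff)
qed

lemma hnorm_mon: "hnorm (weighted_space \<alpha>) (mon n) = 1 / sqrt (wt \<alpha> n)"
  by (simp add: hnorm_def ip_mon coef_mon real_sqrt_divide Re_divide_of_real)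

section \<open>The sum space\<close>

definition component :: "(complex \<Rightarrow> nat \<Rightarrow> complex) \<Rightarrow> nat \<Rightarrow> complex \<Rightarrow> complex"
  where "component F l = (\<lambda>z. F z l)"

lemma component_add [simp]: "component (F + G) l = component F l + component G l"
  and component_zero [simp]: "component 0 l = 0"
  and component_diff [simp]: "component (F - G) l = component F l - component G l"
  and component_scaleC [simp]: "component (c *\<^sub>C F) l = c *\<^sub>C component F l"
  and component_mult_op [simp]: "component (mult_op F) l = zmult (component F l)"
  by (auto simp: component_def scaleC_fun_def mult_op_def zmult_def scaleC_complex_def)

lemma component_sum [simp]: "component (sum F A) l = (\<Sum>i\<in>A. component (F i) l)"
  using sum_comp_morphism[of "\<lambda>F. component F l" F A] by (simp add: o_def)

lemma component_eqI: "(\<And>l. component F l = component G l) \<Longrightarrow> F = G"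
  by (simp add: component_def fun_eq_iff)

locale weighted_sum_space =
  fixes m :: nat and la :: real and \<mu> :: "nat \<Rightarrow> real"
  assumes la: "la > real m / 2" and \<mu>_0: "\<mu> 0 = 1" and \<mu>_pos: "\<And>j. j \<le> m \<Longrightarrow> \<mu> j > 0"
begin

section \<open>The decomposition as a triangular system\<close>

abbreviation W :: "nat \<Rightarrow> (complex \<Rightarrow> complex) ip_space"
  where "W j \<equiv> weighted_space (lamj m la j)"

abbreviation H :: "(complex \<Rightarrow> nat \<Rightarrow> complex) ip_space"
  where "H \<equiv> sum_space m la \<mu>"

lemma lamj_pos [simp]: "0 < lamj m la j"
  using la by (simp add: lamj_def)

lemma lamj_plus: "j \<le> l \<Longrightarrow> lamj m la j + real (l - j) = lamj m la l"
  by (simp add: lamj_def field_simps)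

sublocale W: inner_product_space "W j" for j
  by (rule inner_weighted_space) simp

text \<open>The scalar entries of the lower triangular system relating a decomposition to the
  components of its sum; the diagonal entries are 1.\<close>

definition cst :: "nat \<Rightarrow> nat \<Rightarrow> complex"
  where "cst l j = of_nat (l choose j) * (1 / of_real (pochhammer (2 * lamj m la j) (l - j)))"

lemma cst_self [simp]: "cst l l = 1"
  by (simp add: cst_def)

lemma component_Gam: "component (Gam m la j f) l = (if j \<le> l \<and> l \<le> m then cst l j *\<^sub>C disc_deriv (l - j) f else 0)"
  by (auto simp: component_def Gam_def cst_def disc_deriv_def scaleC_fun_def scaleC_complex_def)

lemma is_decomposition_iff:
  "is_decomposition m la F f \<longleftrightarrow> (\<forall>j\<le>m. f j \<in> vecs (W j)) \<and>
    (\<forall>l. component F l = (if l \<le> m then \<Sum>j\<le>l. cst l j *\<^sub>C disc_deriv (l - j) (f j) else 0))"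
proof -
  have "component (\<Sum>j\<le>m. Gam m la j (f j)) l = (if l \<le> m then \<Sum>j\<le>l. cst l j *\<^sub>C disc_deriv (l - j) (f j) else 0)" for l
    by (auto simp: component_Gam intro!: sum.mono_neutral_cong_right sum.neutral)
  then show ?thesis
    using component_eqI[of F "\<Sum>j\<le>m. Gam m la j (f j)"]
    by (auto simp: is_decomposition_def vecs_disc_space)
qed

text \<open>Forward substitution in the triangular system. It gives an explicit formula in place of
  the chosen \<open>decomposition\<close> and makes sense for every F.\<close>

fun dec :: "(complex \<Rightarrow> nat \<Rightarrow> complex) \<Rightarrow> nat \<Rightarrow> complex \<Rightarrow> complex"
  where "dec F l = component F l - (\<Sum>j<l. cst l j *\<^sub>C disc_deriv (l - j) (dec F j))"

declare dec.simps [simp del]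

lemma disc_deriv_bounded_W:
  assumes "j \<le> l"
  shows "\<exists>C\<ge>0. \<forall>f\<in>vecs (W j). disc_deriv (l - j) f \<in> vecs (W l) \<and> hnorm (W l) (disc_deriv (l - j) f) \<le> C * hnorm (W j) f"
  using disc_deriv_bounded[OF lamj_pos, of j "l - j"] unfolding lamj_plus[OF assms] .

lemma disc_deriv_mem: "f \<in> vecs (W j) \<Longrightarrow> j \<le> l \<Longrightarrow> disc_deriv (l - j) f \<in> vecs (W l)"
  using disc_deriv_bounded_W by blast

lemma component_eq_dec_sum:
  assumes "disc_fun (dec F l)"
  shows "component F l = (\<Sum>j\<le>l. cst l j *\<^sub>C disc_deriv (l - j) (dec F j))"
proof -
  have "(\<Sum>j\<le>l. cst l j *\<^sub>C disc_deriv (l - j) (dec F j)) = (\<Sum>j<l. cst l j *\<^sub>C disc_deriv (l - j) (dec F j)) + dec F l"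
    using assms by (simp add: lessThan_Suc_atMost[symmetric] scaleC_one)
  then show ?thesis by (simp add: dec.simps[of F l])
qed

lemma dec_mem_if_component_mem:
  assumes "\<And>l. l \<le> m \<Longrightarrow> component F l \<in> vecs (W l)"
  shows "l \<le> m \<Longrightarrow> dec F l \<in> vecs (W l)"
proof (induction l rule: less_induct)
  case (less l)
  then show ?case
    unfolding dec.simps[of F l] using assms
    by (intro W.diff_mem W.sum_mem W.scale_mem disc_deriv_mem) auto
qed

lemma decomposition_exists:
  assumes "\<And>l. l \<le> m \<Longrightarrow> component F l \<in> vecs (W l)" and "\<And>l. l > m \<Longrightarrow> component F l = 0"
  shows "is_decomposition m la F (dec F)"
proof -
  have D: "dec F l \<in> vecs (W l)" if "l \<le> m" for l
    using dec_mem_if_component_mem assms(1) that by blast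
  then have "component F l = (\<Sum>j\<le>l. cst l j *\<^sub>C disc_deriv (l - j) (dec F j))" if "l \<le> m" for l
    using component_eq_dec_sum weighted_spaceD(1) that by blast
  with D show ?thesis
    unfolding is_decomposition_iff using assms(2) by simp
qed

text \<open>With unit diagonal, f l is determined by component l and the earlier f j. This contains
  both the injectivity of each \<open>Gam\<close> and the directness of the sum.\<close>

lemma decomposition_unique:
  assumes "is_decomposition m la F f"
  shows "l \<le> m \<Longrightarrow> f l = dec F l"
proof (induction l rule: less_induct)
  case (less l)
  have fl: "f l \<in> vecs (W l)"
    using assms less.prems by (simp add: is_decomposition_iff)
  have "component F l = (\<Sum>j\<le>l. cst l j *\<^sub>C disc_deriv (l - j) (f j))"
    using assms less.prems by (simp add: is_decomposition_iff)
  also have "\<dots> = (\<Sum>j<l. cst l j *\<^sub>C disc_deriv (l - j) (f j)) + f l"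
    using weighted_spaceD(1)[OF fl] by (simp add: lessThan_Suc_atMost[symmetric] scaleC_one)
  also have "(\<Sum>j<l. cst l j *\<^sub>C disc_deriv (l - j) (f j)) = (\<Sum>j<l. cst l j *\<^sub>C disc_deriv (l - j) (dec F j))"
    using less by (intro sum.cong) auto
  finally show "f l = dec F l" by (simp add: dec.simps[of F l] fun_eq_iff)
qed

text \<open>The triangular system and its inverse involve only derivatives mapping
  \<open>W j\<close> into \<open>W l\<close>. As a vector space the sum space is therefore the
  product of the \<open>W l\<close>, on which multiplication by z acts component by
  component.\<close>

lemma vecs_H_iff: "F \<in> vecs H \<longleftrightarrow> (\<forall>l\<le>m. component F l \<in> vecs (W l)) \<and> (\<forall>l>m. component F l = 0)"
proof
  assume "F \<in> vecs H"
  then obtain f where f: "is_decomposition m la F f" by (auto simp: sum_space_def)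
  have "(\<Sum>j\<le>l. cst l j *\<^sub>C disc_deriv (l - j) (f j)) \<in> vecs (W l)" if "l \<le> m" for l
    using f that unfolding is_decomposition_iff
    by (intro W.sum_mem W.scale_mem disc_deriv_mem) auto
  with f show "(\<forall>l\<le>m. component F l \<in> vecs (W l)) \<and> (\<forall>l>m. component F l = 0)"
    unfolding is_decomposition_iff by simp
next
  assume "(\<forall>l\<le>m. component F l \<in> vecs (W l)) \<and> (\<forall>l>m. component F l = 0)"
  then show "F \<in> vecs H" using decomposition_exists[of F] by (auto simp: sum_space_def)
qed

lemma H_component_mem: "F \<in> vecs H \<Longrightarrow> l \<le> m \<Longrightarrow> component F l \<in> vecs (W l)"
  by (simp add: vecs_H_iff)

lemma H_component_eq_0: "F \<in> vecs H \<Longrightarrow> l > m \<Longrightarrow> component F l = 0"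
  by (simp add: vecs_H_iff)

lemma H_disc_fun [simp]: "F \<in> vecs H \<Longrightarrow> disc_fun (component F l)"
  using H_component_mem[of F l] H_component_eq_0[of F l] weighted_spaceD(1) by (cases "l \<le> m") auto

lemma H_eqI:
  assumes "F \<in> vecs H" "G \<in> vecs H" "\<And>l n. l \<le> m \<Longrightarrow> coef (component F l) n = coef (component G l) n"
  shows "F = G"
proof (rule component_eqI)
  show "component F l = component G l" for l
    using assms disc_fun_eqI[of "component F l" "component G l"] H_component_eq_0
      by (cases "l \<le> m") auto
qed

lemma dec_mem: "F \<in> vecs H \<Longrightarrow> l \<le> m \<Longrightarrow> dec F l \<in> vecs (W l)"
  using dec_mem_if_component_mem[of F l] H_component_mem by blast

lemma dec_disc_fun: "F \<in> vecs H \<Longrightarrow> l \<le> m \<Longrightarrow> disc_fun (dec F l)"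
  using dec_mem weighted_spaceD(1) by blast

lemma decomposition_eq_dec: "F \<in> vecs H \<Longrightarrow> l \<le> m \<Longrightarrow> decomposition m la F l = dec F l"
proof -
  assume F: "F \<in> vecs H" and l: "l \<le> m"
  then have "is_decomposition m la F (dec F)"
    by (intro decomposition_exists H_component_mem H_component_eq_0)
  then have "is_decomposition m la F (decomposition m la F)"
    unfolding decomposition_def by (rule someI[of "is_decomposition m la F"])
  then show ?thesis by (rule decomposition_unique) (rule l)
qed

section \<open>The inner product of the sum space\<close>

lemma ip_H:
  assumes "F \<in> vecs H" "G \<in> vecs H"
  shows "ip H F G = (\<Sum>j\<le>m. of_real (1 / (\<mu> j)\<^sup>2) * ip (W j) (dec F j) (dec G j))"
proof -
  have "ip H F G = (\<Sum>j\<le>m. of_real (1 / (\<mu> j)\<^sup>2) *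
      ip (disc_space (lamj m la j)) (decomposition m la F j) (decomposition m la G j))"
    by (simp add: sum_space_def)
  also have "\<dots> = (\<Sum>j\<le>m. of_real (1 / (\<mu> j)\<^sup>2) * ip (W j) (dec F j) (dec G j))"
    using assms by (intro sum.cong refl) (simp add: decomposition_eq_dec ip_disc_space dec_mem)
  finally show ?thesis .
qed

lemma H_add: "F \<in> vecs H \<Longrightarrow> G \<in> vecs H \<Longrightarrow> F + G \<in> vecs H"
  by (simp add: vecs_H_iff)

lemma H_scale: "F \<in> vecs H \<Longrightarrow> c *\<^sub>C F \<in> vecs H"
  by (simp add: vecs_H_iff)

lemma dec_add:
  assumes "F \<in> vecs H" "G \<in> vecs H"
  shows "l \<le> m \<Longrightarrow> dec (F + G) l = dec F l + dec G l"
proof (induction l rule: less_induct)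
  case (less l)
  have IH: "dec (F + G) j = dec F j + dec G j" if "j < l" for j
    by (rule less.IH) (use that less.prems in auto)
  have "(\<Sum>j<l. cst l j *\<^sub>C disc_deriv (l - j) (dec (F + G) j)) =
      (\<Sum>j<l. cst l j *\<^sub>C disc_deriv (l - j) (dec F j)) + (\<Sum>j<l. cst l j *\<^sub>C disc_deriv (l - j) (dec G j))"
    unfolding sum.distrib[symmetric] using less.prems assms
    by (intro sum.cong) (simp_all add: IH disc_deriv_add dec_disc_fun scaleC_add_right)
  then show "dec (F + G) l = dec F l + dec G l" by (simp add: dec.simps[of _ l])
qed

lemma dec_scale:
  assumes "F \<in> vecs H"
  shows "l \<le> m \<Longrightarrow> dec (c *\<^sub>C F) l = c *\<^sub>C dec F l"
proof (induction l rule: less_induct)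
  case (less l)
  have IH: "dec (c *\<^sub>C F) j = c *\<^sub>C dec F j" if "j < l" for j
    by (rule less.IH) (use that less.prems in auto)
  have "(\<Sum>j<l. cst l j *\<^sub>C disc_deriv (l - j) (dec (c *\<^sub>C F) j)) = c *\<^sub>C (\<Sum>j<l. cst l j *\<^sub>C disc_deriv (l - j) (dec F j))"
    unfolding scaleC_sum_right using less.prems assms
    by (intro sum.cong) (simp_all add: IH disc_deriv_scaleC dec_disc_fun scaleC_scaleC mult.commute)
  then show "dec (c *\<^sub>C F) l = c *\<^sub>C dec F l" by (simp add: dec.simps[of _ l] scaleC_diff_right)
qed

lemma Re_ip_H_self:
  assumes "F \<in> vecs H"
  shows "Re (ip H F F) = (\<Sum>j\<le>m. (hnorm (W j) (dec F j) / \<mu> j)\<^sup>2)"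
  unfolding ip_H[OF assms assms] Re_sum
  using assms by (intro sum.cong refl) (simp add: W.ip_self dec_mem power_divide flip: of_real_power of_real_mult of_real_divide)

sublocale H: inner_product_space H
proof
  show "0 \<in> vecs H" by (simp add: vecs_H_iff)
  show "F + G \<in> vecs H" if "F \<in> vecs H" "G \<in> vecs H" for F G using that by (rule H_add)
  show "c *\<^sub>C F \<in> vecs H" if "F \<in> vecs H" for F c using that by (rule H_scale)
  show "ip H (F + G) K = ip H F K + ip H G K" if "F \<in> vecs H" "G \<in> vecs H" "K \<in> vecs H" for F G K
    using that unfolding ip_H[OF that(1,3)] ip_H[OF that(2,3)] ip_H[OF H_add[OF that(1,2)] that(3)] sum.distrib[symmetric]
    by (intro sum.cong refl) (simp add: dec_add W.ip_add_left dec_mem add_divide_distrib distrib_left)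
  show "ip H (c *\<^sub>C F) G = c * ip H F G" if "F \<in> vecs H" "G \<in> vecs H" for F G c
    using that unfolding ip_H[OF that] ip_H[OF H_scale[OF that(1)] that(2)] sum_distrib_left
    by (intro sum.cong refl) (simp add: dec_scale W.ip_scale_left dec_mem)
  show "ip H G F = cnj (ip H F G)" if "F \<in> vecs H" "G \<in> vecs H" for F G
    unfolding ip_H[OF that] ip_H[OF that(2,1)] cnj_sum
  proof (intro sum.cong refl)
    fix j assume "j \<in> {..m}"
    then show "of_real (1 / (\<mu> j)\<^sup>2) * ip (W j) (dec G j) (dec F j) =
        cnj (of_real (1 / (\<mu> j)\<^sup>2) * ip (W j) (dec F j) (dec G j))"
      using W.ip_commute[OF dec_mem[OF that(1)] dec_mem[OF that(2)], of j] by simp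
  qed
  show "0 < Re (ip H F F)" if F: "F \<in> vecs H" and nz: "F \<noteq> 0" for F
  proof -
    have "\<exists>j\<le>m. dec F j \<noteq> 0"
    proof (rule ccontr)
      assume "\<not> ?thesis"
      then have "component F l = 0" if "l \<le> m" for l
        using component_eq_dec_sum[of F l] that by simp
      then have "F = 0" using H_component_eq_0[OF F]
        by (intro component_eqI) (metis component_zero not_le)
      with nz show False ..
    qed
    then obtain j where "j \<le> m" "dec F j \<noteq> 0" by blast
    then have "0 < (hnorm (W j) (dec F j) / \<mu> j)\<^sup>2"
      using dec_mem[OF F] \<mu>_pos[of j] by simp
    then show ?thesis
      unfolding Re_ip_H_self[OF F] using \<open>j \<le> m\<close>
      by (intro sum_pos2[of _ j]) auto
  qed
qed

section \<open>Equivalence of the norm with the componentwise norms\<close>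

lemma hnorm_H:
  assumes "F \<in> vecs H"
  shows "hnorm H F = L2_set (\<lambda>j. hnorm (W j) (dec F j) / \<mu> j) {..m}"
  by (simp add: hnorm_def[of H] Re_ip_H_self[OF assms] L2_set_def)

text \<open>The condition j \<le> l stands inside the formula so that a constant exists for every j,
  and one function D can be obtained for all indices at once.\<close>

lemma disc_deriv_bound:
  "\<exists>C\<ge>0. \<forall>f\<in>vecs (W j). j \<le> l \<longrightarrow> hnorm (W l) (cst l j *\<^sub>C disc_deriv (l - j) f) \<le> C * hnorm (W j) f"
proof (cases "j \<le> l")
  case True
  from disc_deriv_bounded_W[OF True]
  obtain C where C: "C \<ge> 0"
    "\<And>f. f \<in> vecs (W j) \<Longrightarrow> hnorm (W l) (disc_deriv (l - j) f) \<le> C * hnorm (W j) f"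
    by blast
  have "hnorm (W l) (cst l j *\<^sub>C disc_deriv (l - j) f) \<le> (norm (cst l j) * C) * hnorm (W j) f"
    if "f \<in> vecs (W j)" for f
    using mult_left_mono[OF C(2)[OF that], of "norm (cst l j)"] disc_deriv_mem[OF that True]
    by (simp add: W.hnorm_scale mult.assoc)
  then show ?thesis using C(1) by (intro exI[of _ "norm (cst l j) * C"]) simp
qed auto

text \<open>Forward substitution with norms: the constant for l is 1 for the component itself plus,
  for each j < l, the norm of the derivative map times the constant already found for j.\<close>

lemma hnorm_dec_le:
  "l \<le> m \<Longrightarrow> \<exists>C\<ge>0. \<forall>F\<in>vecs H. hnorm (W l) (dec F l) \<le> C * (\<Sum>j\<le>m. hnorm (W j) (component F j))"
proof (induction l rule: less_induct)
  case (less l)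
  let ?S = "\<lambda>F. \<Sum>j\<le>m. hnorm (W j) (component F j)"
  have "\<forall>j\<in>{..<l}. \<exists>C\<ge>0. \<forall>F\<in>vecs H. hnorm (W j) (dec F j) \<le> C * ?S F"
    using less by auto
  then obtain C where C: "\<And>j. j < l \<Longrightarrow> 0 \<le> C j"
    "\<And>j F. j < l \<Longrightarrow> F \<in> vecs H \<Longrightarrow> hnorm (W j) (dec F j) \<le> C j * ?S F"
    unfolding bchoice_iff by auto
  obtain D where D: "\<And>j. 0 \<le> D j"
    "\<And>j f. f \<in> vecs (W j) \<Longrightarrow> j \<le> l \<Longrightarrow> hnorm (W l) (cst l j *\<^sub>C disc_deriv (l - j) f) \<le> D j * hnorm (W j) f"
    using disc_deriv_bound[of _ l] by metis
  have "hnorm (W l) (dec F l) \<le> (1 + (\<Sum>j<l. D j * C j)) * ?S F" if F: "F \<in> vecs H" for F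
  proof -
    have mem: "cst l j *\<^sub>C disc_deriv (l - j) (dec F j) \<in> vecs (W l)" if "j < l" for j
      using that less.prems F by (intro W.scale_mem disc_deriv_mem dec_mem) auto
    have "hnorm (W l) (dec F l) \<le> hnorm (W l) (component F l) + hnorm (W l) (\<Sum>j<l. cst l j *\<^sub>C disc_deriv (l - j) (dec F j))"
      unfolding dec.simps[of F l] using mem less.prems F
      by (intro W.hnorm_triangle_diff H_component_mem W.sum_mem) auto
    also have "hnorm (W l) (\<Sum>j<l. cst l j *\<^sub>C disc_deriv (l - j) (dec F j)) \<le> (\<Sum>j<l. hnorm (W l) (cst l j *\<^sub>C disc_deriv (l - j) (dec F j)))"
      using mem by (intro W.hnorm_sum_le) auto
    also have "\<dots> \<le> (\<Sum>j<l. (D j * C j) * ?S F)"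
    proof (rule sum_mono)
      fix j assume j: "j \<in> {..<l}"
      have "hnorm (W l) (cst l j *\<^sub>C disc_deriv (l - j) (dec F j)) \<le> D j * hnorm (W j) (dec F j)"
        using j less.prems F by (intro D dec_mem) auto
      also have "\<dots> \<le> D j * (C j * ?S F)"
        using j F by (intro mult_left_mono C D) auto
      finally show "hnorm (W l) (cst l j *\<^sub>C disc_deriv (l - j) (dec F j)) \<le> (D j * C j) * ?S F"
        by (simp only: mult.assoc)
    qed
    also have "hnorm (W l) (component F l) \<le> ?S F"
      using less.prems F H_component_mem by (intro member_le_sum) auto
    finally show ?thesis by (simp add: distrib_right sum_distrib_right)
  qed
  moreover have "0 \<le> 1 + (\<Sum>j<l. D j * C j)"
    using C D by (intro add_nonneg_nonneg sum_nonneg mult_nonneg_nonneg) auto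
  ultimately show ?case by blast
qed

text \<open>One half of the norm equivalence: the norm is a weighted Euclidean combination of the
  norms of the \<open>dec F j\<close>, hence at most their weighted sum, and these are controlled by
  the components.\<close>

lemma hnorm_H_le:
  "\<exists>C\<ge>0. \<forall>F\<in>vecs H. hnorm H F \<le> C * (\<Sum>j\<le>m. hnorm (W j) (component F j))"
proof -
  let ?S = "\<lambda>F. \<Sum>j\<le>m. hnorm (W j) (component F j)"
  have "\<forall>j\<in>{..m}. \<exists>C\<ge>0. \<forall>F\<in>vecs H. hnorm (W j) (dec F j) \<le> C * ?S F"
    using hnorm_dec_le by auto
  then obtain C where C: "\<And>j. j \<le> m \<Longrightarrow> 0 \<le> C j"
    "\<And>j F. j \<le> m \<Longrightarrow> F \<in> vecs H \<Longrightarrow> hnorm (W j) (dec F j) \<le> C j * ?S F"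
    unfolding bchoice_iff by auto
  have "hnorm H F \<le> (\<Sum>j\<le>m. C j / \<mu> j) * ?S F" if F: "F \<in> vecs H" for F
  proof -
    have "hnorm H F \<le> (\<Sum>j\<le>m. hnorm (W j) (dec F j) / \<mu> j)"
      unfolding hnorm_H[OF F] using F \<mu>_pos
      by (intro L2_set_le_sum) (auto intro!: divide_nonneg_pos W.hnorm_nonneg dec_mem)
    also have "\<dots> \<le> (\<Sum>j\<le>m. C j * ?S F / \<mu> j)"
      using F C \<mu>_pos by (intro sum_mono divide_right_mono) (auto simp: less_imp_le)
    finally show ?thesis by (simp add: sum_distrib_right)
  qed
  moreover have "0 \<le> (\<Sum>j\<le>m. C j / \<mu> j)"
    using C \<mu>_pos by (intro sum_nonneg divide_nonneg_pos) auto
  ultimately show ?thesis by blast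
qed

lemma hnorm_dec_le_H:
  assumes "F \<in> vecs H" "j \<le> m"
  shows "hnorm (W j) (dec F j) \<le> \<mu> j * hnorm H F"
proof -
  have "hnorm (W j) (dec F j) / \<mu> j \<le> hnorm H F"
    unfolding hnorm_H[OF assms(1)] using assms by (intro member_le_L2_set) auto
  then show ?thesis using \<mu>_pos[OF assms(2)] by (simp add: field_simps)
qed

text \<open>The other half of the norm equivalence: a component is a finite sum of bounded
  derivatives of the \<open>dec F j\<close>, each of which is controlled by the norm of F.\<close>

lemma hnorm_component_le:
  assumes "l \<le> m"
  shows "\<exists>C\<ge>0. \<forall>F\<in>vecs H. hnorm (W l) (component F l) \<le> C * hnorm H F"
proof -
  obtain D where D: "\<And>j. 0 \<le> D j"
    "\<And>j f. f \<in> vecs (W j) \<Longrightarrow> j \<le> l \<Longrightarrow> hnorm (W l) (cst l j *\<^sub>C disc_deriv (l - j) f) \<le> D j * hnorm (W j) f"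
    using disc_deriv_bound[of _ l] by metis
  have "hnorm (W l) (component F l) \<le> (\<Sum>j\<le>l. D j * \<mu> j) * hnorm H F" if F: "F \<in> vecs H" for F
  proof -
    have mem: "cst l j *\<^sub>C disc_deriv (l - j) (dec F j) \<in> vecs (W l)" if "j \<le> l" for j
      using that assms F by (intro W.scale_mem disc_deriv_mem dec_mem) auto
    have "hnorm (W l) (component F l) \<le> (\<Sum>j\<le>l. hnorm (W l) (cst l j *\<^sub>C disc_deriv (l - j) (dec F j)))"
      unfolding component_eq_dec_sum[OF dec_disc_fun[OF F assms]] using mem
        by (intro W.hnorm_sum_le) auto
    also have "\<dots> \<le> (\<Sum>j\<le>l. D j * (\<mu> j * hnorm H F))"
    proof (rule sum_mono)
      fix j assume j: "j \<in> {..l}"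
      have "hnorm (W l) (cst l j *\<^sub>C disc_deriv (l - j) (dec F j)) \<le> D j * hnorm (W j) (dec F j)"
        using j assms F by (intro D dec_mem) auto
      also have "\<dots> \<le> D j * (\<mu> j * hnorm H F)"
        using j assms F by (intro mult_left_mono hnorm_dec_le_H D) auto
      finally show "hnorm (W l) (cst l j *\<^sub>C disc_deriv (l - j) (dec F j)) \<le> D j * (\<mu> j * hnorm H F)" .
    qed
    finally show ?thesis by (simp add: sum_distrib_right mult.assoc)
  qed
  moreover have "0 \<le> (\<Sum>j\<le>l. D j * \<mu> j)"
    using D \<mu>_pos assms by (intro sum_nonneg mult_nonneg_nonneg) (auto simp: less_imp_le)
  ultimately show ?thesis by blast
qed

section \<open>Boundedness of multiplication by z on the sum space\<close>

lemma mult_op_mem [simp]: "F \<in> vecs H \<Longrightarrow> mult_op F \<in> vecs H"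
  unfolding vecs_H_iff by (simp add: zmult_bound(1)[OF lamj_pos])

lemma mult_op_add: "mult_op (F + G) = mult_op F + mult_op G"
  by (rule component_eqI) (simp add: zmult_add)

lemma mult_op_scale: "mult_op (c *\<^sub>C F) = c *\<^sub>C mult_op F"
  by (rule component_eqI) (simp add: zmult_scaleC)

text \<open>In the decomposition, multiplication by z in general mixes the summands, as it does not
  commute with derivatives. The estimate therefore passes to the components, where it is
  \<open>zmult\<close>, and back through the norm equivalence.\<close>

lemma bounded_mult_op: "bounded_operator H mult_op"
proof -
  obtain C where C: "C \<ge> 0" "\<And>F. F \<in> vecs H \<Longrightarrow> hnorm H F \<le> C * (\<Sum>j\<le>m. hnorm (W j) (component F j))"
    using hnorm_H_le by auto
  have "\<forall>l\<in>{..m}. \<exists>C\<ge>0. \<forall>F\<in>vecs H. hnorm (W l) (component F l) \<le> C * hnorm H F"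
    using hnorm_component_le by auto
  then obtain D where D: "\<And>l. l \<le> m \<Longrightarrow> 0 \<le> D l"
    "\<And>l F. l \<le> m \<Longrightarrow> F \<in> vecs H \<Longrightarrow> hnorm (W l) (component F l) \<le> D l * hnorm H F"
    unfolding bchoice_iff by auto
  define E where "E = (\<lambda>l. sqrt (1 + 1 / (2 * lamj m la l)))"
  have E: "0 \<le> E l" for l unfolding E_def by (simp add: less_imp_le)
  have "hnorm H (mult_op F) \<le> C * (\<Sum>l\<le>m. E l * D l) * hnorm H F" if F: "F \<in> vecs H" for F
  proof -
    have "hnorm H (mult_op F) \<le> C * (\<Sum>l\<le>m. hnorm (W l) (zmult (component F l)))"
      using C(2)[OF mult_op_mem[OF F]] by simp
    also have "\<dots> \<le> C * (\<Sum>l\<le>m. E l * (D l * hnorm H F))"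
    proof (intro mult_left_mono sum_mono C(1))
      fix l assume l: "l \<in> {..m}"
      have "hnorm (W l) (zmult (component F l)) \<le> E l * hnorm (W l) (component F l)"
        unfolding E_def using l F by (intro zmult_bound H_component_mem) auto
      also have "\<dots> \<le> E l * (D l * hnorm H F)"
        using l F by (intro mult_left_mono D E) auto
      finally show "hnorm (W l) (zmult (component F l)) \<le> E l * (D l * hnorm H F)" .
    qed
    finally show ?thesis by (simp add: sum_distrib_right mult.assoc)
  qed
  then show ?thesis
    unfolding bounded_operator_def by (auto simp: mult_op_add mult_op_scale)
qed

end

section \<open>Irreducibility\<close>

text \<open>The quotient is the squared norm of z^n for \<alpha> + l over that of z^(n+l) for
  \<alpha>: two monomials of equal degree in components l and 0. It telescopes into unit shifts of
  the parameter, each contributing a factor that tends to 0.\<close>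

lemma wt_ratio_tendsto:
  "\<alpha> > 0 \<Longrightarrow> (\<lambda>n. wt \<alpha> (n + l) / wt (\<alpha> + l) n) \<longlonglongrightarrow> (if l = 0 then 1 else 0)"
proof (induction l arbitrary: \<alpha>)
  case 0
  then show ?case by simp
next
  case (Suc l)
  let ?C = "2 * \<alpha> * (2 * \<alpha> + 1)"
  have "(\<lambda>n. wt \<alpha> (Suc n) / wt (\<alpha> + 1) n) \<longlonglongrightarrow> 0"
  proof (rule Lim_null_comparison)
    show "(\<lambda>n. ?C * inverse (real (Suc n))) \<longlonglongrightarrow> 0"
      using tendsto_mult_right_zero[OF LIMSEQ_inverse_real_of_nat] .
    have "norm (wt \<alpha> (Suc n) / wt (\<alpha> + 1) n) \<le> ?C * inverse (real (Suc n))" for n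
    proof -
      have "wt \<alpha> (Suc n) / wt (\<alpha> + 1) n = ?C / ((n + 1) * (2 * \<alpha> + n + 1))"
        using wt_Suc_shift[OF Suc.prems, of n] Suc.prems by simp
      also have "\<dots> \<le> ?C / ((n + 1) * 1)"
        using Suc.prems by (intro divide_left_mono mult_left_mono mult_pos_pos) auto
      finally show ?thesis using Suc.prems by (simp add: divide_inverse)
    qed
    then show "\<forall>\<^sub>F n in sequentially. norm (wt \<alpha> (Suc n) / wt (\<alpha> + 1) n) \<le> ?C * inverse (real (Suc n))"
      by (rule always_eventually[OF allI])
  qed
  from LIMSEQ_ignore_initial_segment[OF this, of l]
  have "(\<lambda>n. wt \<alpha> (Suc (n + l)) / wt (\<alpha> + 1) (n + l)) \<longlonglongrightarrow> 0" .
  from tendsto_mult[OF this Suc.IH[of "\<alpha> + 1"]] Suc.prems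
  have "(\<lambda>n. wt \<alpha> (Suc (n + l)) / wt (\<alpha> + 1) (n + l) * (wt (\<alpha> + 1) (n + l) / wt (\<alpha> + 1 + l) n)) \<longlonglongrightarrow> 0"
    by simp
  moreover have "wt \<alpha> (Suc (n + l)) / wt (\<alpha> + 1) (n + l) * (wt (\<alpha> + 1) (n + l) / wt (\<alpha> + 1 + l) n)
      = wt \<alpha> (n + Suc l) / wt (\<alpha> + Suc l) n" for n
    using wt_nonzero[of "\<alpha> + 1" "n + l"] Suc.prems by (simp add: add.assoc)
  ultimately show ?case by simp
qed

context weighted_sum_space
begin

section \<open>Kernels of the component values at 0\<close>

lemma
  assumes "\<And>j. j \<le> m \<Longrightarrow> f j \<in> vecs (W j)"
  shows Gam_sum_mem: "(\<Sum>j\<le>m. Gam m la j (f j)) \<in> vecs H"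
    and dec_Gam_sum: "l \<le> m \<Longrightarrow> dec (\<Sum>j\<le>m. Gam m la j (f j)) l = f l"
proof -
  have D: "is_decomposition m la (\<Sum>j\<le>m. Gam m la j (f j)) f"
    using assms by (simp add: is_decomposition_def vecs_disc_space)
  then show "(\<Sum>j\<le>m. Gam m la j (f j)) \<in> vecs H" by (auto simp: sum_space_def)
  show "l \<le> m \<Longrightarrow> dec (\<Sum>j\<le>m. Gam m la j (f j)) l = f l"
    using decomposition_unique[OF D] by simp
qed

text \<open>Represents the functional taking F to the value of component l at 0. Summand j must
  reproduce \<open>cst l j * fact (l - j) * coef f (l - j)\<close> under the inner product scaled by
  the inverse square of \<open>\<mu> j\<close>. The rising factorial in \<open>cst\<close> and the
  factorial combine to 1 / \<open>wt\<close>, which \<open>mon\<close> supplies, so only the square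
  of \<open>\<mu> j\<close> and the binomial coefficient remain.\<close>

definition zero_kernel :: "nat \<Rightarrow> complex \<Rightarrow> nat \<Rightarrow> complex"
  where "zero_kernel l = (\<Sum>j\<le>m. Gam m la j (of_real ((\<mu> j)\<^sup>2 * (l choose j)) *\<^sub>C mon (l - j)))"

lemma zero_kernel_mem [simp]: "zero_kernel l \<in> vecs H"
  unfolding zero_kernel_def by (intro Gam_sum_mem W.scale_mem mon_mem lamj_pos)

lemma dec_zero_kernel: "j \<le> m \<Longrightarrow> dec (zero_kernel l) j = of_real ((\<mu> j)\<^sup>2 * (l choose j)) *\<^sub>C mon (l - j)"
  unfolding zero_kernel_def by (intro dec_Gam_sum W.scale_mem mon_mem lamj_pos)

lemma coef_component:
  assumes "F \<in> vecs H" "l \<le> m"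
  shows "coef (component F l) n = (\<Sum>j\<le>l. cst l j * (fact (n + (l - j)) / fact n * coef (dec F j) (n + (l - j))))"
proof -
  have d: "disc_fun (dec F j)" if "j \<le> l" for j
    using that assms by (intro dec_disc_fun) auto
  have "coef (component F l) n = (\<Sum>j\<le>l. coef (cst l j *\<^sub>C disc_deriv (l - j) (dec F j)) n)"
    unfolding component_eq_dec_sum[OF d[OF order_refl]] by (intro coef_sum) (simp add: d)
  also have "\<dots> = (\<Sum>j\<le>l. cst l j * (fact (n + (l - j)) / fact n * coef (dec F j) (n + (l - j))))"
    by (intro sum.cong refl) (simp add: d)
  finally show ?thesis .
qed

lemma ip_zero_kernel:
  assumes F: "F \<in> vecs H" and l: "l \<le> m"
  shows "ip H F (zero_kernel l) = coef (component F l) 0"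
proof -
  have "ip H F (zero_kernel l) = (\<Sum>j\<le>m. of_nat (l choose j) * (coef (dec F j) (l - j) / of_real (wt (lamj m la j) (l - j))))"
    unfolding ip_H[OF F zero_kernel_mem]
  proof (intro sum.cong refl)
    fix j assume "j \<in> {..m}"
    then have j: "j \<le> m" by simp
    have "ip (W j) (dec F j) (dec (zero_kernel l) j) = of_real ((\<mu> j)\<^sup>2) * (of_nat (l choose j) * (coef (dec F j) (l - j) / of_real (wt (lamj m la j) (l - j))))"
      unfolding dec_zero_kernel[OF j] W.ip_scale_right[OF dec_mem[OF F j] mon_mem[OF lamj_pos]]
        by (simp add: ip_mon)
    then show "of_real (1 / (\<mu> j)\<^sup>2) * ip (W j) (dec F j) (dec (zero_kernel l) j) =
        of_nat (l choose j) * (coef (dec F j) (l - j) / of_real (wt (lamj m la j) (l - j)))"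
      using \<mu>_pos[OF j] by simp
  qed
  also have "\<dots> = (\<Sum>j\<le>l. of_nat (l choose j) * (coef (dec F j) (l - j) / of_real (wt (lamj m la j) (l - j))))"
    using l by (intro sum.mono_neutral_right) auto
  also have "\<dots> = coef (component F l) 0"
    unfolding coef_component[OF F l] by (intro sum.cong) (simp_all add: cst_def wt_def)
  finally show ?thesis .
qed

section \<open>The grading by degree\<close>

definition homog :: "nat \<Rightarrow> (complex \<Rightarrow> nat \<Rightarrow> complex) \<Rightarrow> bool"
  where "homog N F \<longleftrightarrow> (\<forall>l\<le>m. \<forall>n. n + l \<noteq> N \<longrightarrow> coef (component F l) n = 0)"

lemma homogD: "homog N F \<Longrightarrow> l \<le> m \<Longrightarrow> n + l \<noteq> N \<Longrightarrow> coef (component F l) n = 0"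
  by (simp add: homog_def)

text \<open>\<open>Gam\<close> respects degrees: passing from summand j to component l lowers the
  power of z by l - j and raises the index by the same amount. Forward substitution then keeps the
  decomposition in the same degree.\<close>

lemma homog_coef_dec:
  assumes F: "F \<in> vecs H" and "homog N F"
  shows "l \<le> m \<Longrightarrow> n + l \<noteq> N \<Longrightarrow> coef (dec F l) n = 0"
proof (induction l arbitrary: n rule: less_induct)
  case (less l)
  have "coef (dec F j) (n + (l - j)) = 0" if "j < l" for j
    using that less by simp
  moreover have "coef (component F l) n = (\<Sum>j<l. cst l j * (fact (n + (l - j)) / fact n * coef (dec F j) (n + (l - j)))) + coef (dec F l) n"
    unfolding coef_component[OF F less.prems(1)] by (simp add: lessThan_Suc_atMost[symmetric])
  ultimately show ?case using homogD[OF \<open>homog N F\<close> less.prems] by simp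
qed

text \<open>For each j the functions \<open>dec F j\<close> and \<open>dec G j\<close> have their
  coefficients supported at different powers of z, so the inner product vanishes term by
  term.\<close>

lemma homog_orthogonal:
  assumes "F \<in> vecs H" "G \<in> vecs H" "homog N F" "homog N' G" "N \<noteq> N'"
  shows "ip H F G = 0"
proof -
  have "ip (W j) (dec F j) (dec G j) = 0" if "j \<le> m" for j
  proof -
    have "coef (dec F j) n * cnj (coef (dec G j) n) = 0" for n
      using homog_coef_dec[OF assms(1,3) that, of n] homog_coef_dec[OF assms(2,4) that, of n] assms(5)
      by (cases "n + j = N") auto
    then show ?thesis unfolding weighted_ip by (simp only:) simp
  qed
  then show ?thesis unfolding ip_H[OF assms(1,2)] by simp
qed

lemma homog_zero_kernel: "homog l (zero_kernel l)"
  unfolding homog_def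
proof (intro allI impI)
  fix p n assume p: "p \<le> m" and n: "n + p \<noteq> l"
  have "coef (dec (zero_kernel l) j) (n + (p - j)) = 0" if "j \<le> p" for j
  proof -
    \<comment> \<open>For j > l truncated subtraction turns \<open>mon (l - j)\<close> into
      \<open>mon 0\<close>, but there the binomial coefficient is 0.\<close>
    have "of_nat (l choose j) * coef (mon (l - j)) (n + (p - j)) = (0::complex)"
      using n that by (cases "j \<le> l") (auto simp: coef_mon)
    then show ?thesis using that p by (simp add: dec_zero_kernel)
  qed
  then show "coef (component (zero_kernel l) p) n = 0"
    unfolding coef_component[OF zero_kernel_mem p] by simp
qed

text \<open>Only summand 0 enters component 0, and its factor is 1 because
  \<open>\<mu> 0 = 1\<close>. This is the normalization required by the asymptotics.\<close>

lemma coef_zero_kernel_0: "coef (component (zero_kernel l) 0) l = 1"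
  unfolding coef_component[OF zero_kernel_mem le0] by (simp add: dec_zero_kernel coef_mon \<mu>_0)

section \<open>Asymptotics of powers of the multiplication operator\<close>

lemma mult_pow_mem [simp]: "F \<in> vecs H \<Longrightarrow> (mult_op ^^ b) F \<in> vecs H"
  by (induction b) simp_all

lemma coef_mult_pow:
  "F \<in> vecs H \<Longrightarrow> coef (component ((mult_op ^^ b) F) l) n = (if n < b then 0 else coef (component F l) (n - b))"
proof (induction b arbitrary: n)
  case (Suc b)
  then show ?case by (cases n) simp_all
qed simp

lemma homog_mult_pow: "F \<in> vecs H \<Longrightarrow> homog N F \<Longrightarrow> homog (N + b) ((mult_op ^^ b) F)"
  by (auto simp: homog_def coef_mult_pow)

text \<open>The leading part of a normalized homogeneous vector of large degree T obtained by
  multiplying with a power of z.\<close>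

definition evec :: "nat \<Rightarrow> complex \<Rightarrow> nat \<Rightarrow> complex"
  where "evec T = (\<lambda>z l. if l = 0 then mon T z else 0)"

lemma component_evec: "component (evec T) l = (if l = 0 then mon T else 0)"
  by (auto simp: component_def evec_def)

lemma evec_mem [simp]: "evec T \<in> vecs H"
  by (simp add: vecs_H_iff component_evec mon_mem)

text \<open>The later entries of \<open>dec (evec T)\<close> offset the derivatives of z^T that
  entry 0 puts into higher components, and may add to the norm. A lower bound suffices, as the norm
  will stand in a denominator.\<close>

lemma hnorm_evec_ge: "1 / sqrt (wt (lamj m la 0) T) \<le> hnorm H (evec T)"
proof -
  have "dec (evec T) 0 = mon T" by (simp add: dec.simps[of _ 0] component_evec)
  then show ?thesis using hnorm_dec_le_H[of "evec T" 0] by (simp add: \<mu>_0 hnorm_mon)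
qed

lemma hnorm_evec_pos: "0 < hnorm H (evec T)"
  by (rule less_le_trans[OF _ hnorm_evec_ge]) simp

text \<open>The remainder R b has one monomial of degree N + b in each component l with 1 \<le> l
  \<le> N, with a coefficient independent of b. Relative to z^(N+b) in component 0 the norms of
  these monomials tend to 0 by \<open>wt_ratio_tendsto\<close>.\<close>

lemma mult_pow_asymp:
  assumes F: "F \<in> vecs H" and hom: "homog N F" and one: "coef (component F 0) N = 1"
  shows "(\<lambda>b. hnorm H ((mult_op ^^ b) F - evec (N + b)) / hnorm H (evec (N + b))) \<longlonglongrightarrow> 0"
proof -
  obtain C where C: "C \<ge> 0" "\<And>F. F \<in> vecs H \<Longrightarrow> hnorm H F \<le> C * (\<Sum>j\<le>m. hnorm (W j) (component F j))"
    using hnorm_H_le by auto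
  define R where "R = (\<lambda>b. (mult_op ^^ b) F - evec (N + b))"
  define u where "u = (\<lambda>l. coef (component F l) (N - l))"
  define q where "q = (\<lambda>l n. wt (lamj m la 0) (n + l) / wt (lamj m la 0 + l) n)"
  have R: "R b \<in> vecs H" for b using F by (simp add: R_def)
  have cR: "component (R b) l = (if l \<noteq> 0 \<and> l \<le> N then u l *\<^sub>C mon (b + (N - l)) else 0)"
    if l: "l \<le> m" for b l
  proof -
    have co: "coef (component (R b) l) n = (if n < b then 0 else coef (component F l) (n - b)) - coef (component (evec (N + b)) l) n" for n
      unfolding R_def using F by (simp add: coef_mult_pow)
    have "coef (component (R b) l) n = coef (if l \<noteq> 0 \<and> l \<le> N then u l *\<^sub>C mon (b + (N - l)) else 0) n" for n
    proof (cases "l \<noteq> 0 \<and> l \<le> N")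
      case True
      then show ?thesis
        using homogD[OF hom l, of "n - b"] unfolding co
        by (cases "n = b + (N - l)") (auto simp: component_evec u_def coef_mon)
    next
      case False
      then show ?thesis
        using homogD[OF hom l, of "n - b"] one unfolding co
        by (cases "l = 0") (auto simp: component_evec coef_mon)
    qed
    then show ?thesis using R by (intro disc_fun_eqI) auto
  qed
  \<comment> \<open>The root of the weight is the reciprocal of the norm of z^(N+b) in
    \<open>W 0\<close>, so the left side is a relative norm. The shift b + (N - l) is the power of z
    occurring in component l.\<close>
  have sqrt_mult: "sqrt (wt (lamj m la 0) (N + b)) * hnorm (W l) (component (R b) l)
      \<le> norm (u l) * (if l = 0 then 0 else sqrt (q l (b + (N - l))))" if l: "l \<le> m" for l b
  proof (cases "l \<noteq> 0 \<and> l \<le> N")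
    case True
    then have "b + (N - l) + l = N + b" by simp
    moreover have "lamj m la 0 + l = lamj m la l" by (simp add: lamj_def)
    ultimately have "q l (b + (N - l)) = wt (lamj m la 0) (N + b) / wt (lamj m la l) (b + (N - l))"
      unfolding q_def by (simp only:)
    then show ?thesis
      unfolding cR[OF l] using True
      by (simp add: W.hnorm_scale mon_mem hnorm_mon real_sqrt_divide mult.commute)
  next
    case False
    have "0 \<le> sqrt (q l (b + (N - l)))"
      unfolding q_def by (intro real_sqrt_ge_zero divide_nonneg_nonneg wt_nonneg add_pos_nonneg lamj_pos) simp
    then have "0 \<le> norm (u l) * (if l = 0 then 0 else sqrt (q l (b + (N - l))))" by simp
    then show ?thesis unfolding cR[OF l] if_not_P[OF False] by simp
  qed
  have "(\<lambda>b. C * (\<Sum>l\<le>m. norm (u l) * (if l = 0 then 0 else sqrt (q l (b + (N - l)))))) \<longlonglongrightarrow>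
      C * (\<Sum>l\<le>m. norm (u l) * 0)"
  proof (intro tendsto_mult tendsto_sum tendsto_const)
    fix l
    have "(\<lambda>b. sqrt (q l (b + (N - l)))) \<longlonglongrightarrow> 0" if "l \<noteq> 0"
      using tendsto_real_sqrt[OF LIMSEQ_ignore_initial_segment[OF wt_ratio_tendsto[OF lamj_pos, of 0 l]]] that
      by (simp add: q_def)
    then show "(\<lambda>b. if l = 0 then 0 else sqrt (q l (b + (N - l)))) \<longlonglongrightarrow> 0" by (cases "l = 0") simp_all
  qed
  then have lim: "(\<lambda>b. C * (\<Sum>l\<le>m. norm (u l) * (if l = 0 then 0 else sqrt (q l (b + (N - l)))))) \<longlonglongrightarrow> 0"
    by simp
  have "norm (hnorm H (R b) / hnorm H (evec (N + b))) \<le>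
      C * (\<Sum>l\<le>m. norm (u l) * (if l = 0 then 0 else sqrt (q l (b + (N - l)))))" for b
  proof -
    let ?s = "sqrt (wt (lamj m la 0) (N + b))"
    have s: "0 < ?s" by simp
    have "hnorm H (R b) / hnorm H (evec (N + b)) \<le> hnorm H (R b) / (1 / ?s)"
      using R s hnorm_evec_pos hnorm_evec_ge by (intro divide_left_mono mult_pos_pos) simp_all
    also have "\<dots> = ?s * hnorm H (R b)" by simp
    also have "\<dots> \<le> ?s * (C * (\<Sum>l\<le>m. hnorm (W l) (component (R b) l)))"
      using s by (intro mult_left_mono C(2) R) simp
    also have "\<dots> = C * (\<Sum>l\<le>m. ?s * hnorm (W l) (component (R b) l))"
      by (simp add: sum_distrib_left mult_ac)
    also have "\<dots> \<le> C * (\<Sum>l\<le>m. norm (u l) * (if l = 0 then 0 else sqrt (q l (b + (N - l)))))"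
      by (intro mult_left_mono sum_mono sqrt_mult C(1)) simp
    finally show ?thesis using R hnorm_evec_pos[of "N + b"] by simp
  qed
  then have "(\<lambda>b. hnorm H (R b) / hnorm H (evec (N + b))) \<longlonglongrightarrow> 0"
    by (intro Lim_null_comparison[OF _ lim] always_eventually allI)
  then show ?thesis by (simp only: R_def)
qed

text \<open>For large powers both vectors differ from the same \<open>evec\<close> e by less than a
  third of its norm. Their inner product then differs from the squared norm of e by at most 1/9 +
  1/3 + 1/3 = 7/9 of it.\<close>

lemma mult_pow_not_orthogonal:
  assumes F: "F \<in> vecs H" "homog N F" "coef (component F 0) N = 1"
    and G: "G \<in> vecs H" "homog N' G" "coef (component G 0) N' = 1"
  obtains a b where "a + N = b + N'" "ip H ((mult_op ^^ a) F) ((mult_op ^^ b) G) \<noteq> 0"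
proof -
  have ev: "\<exists>B. \<forall>b\<ge>B. hnorm H ((mult_op ^^ b) F - evec (N + b)) < 1 / 3 * hnorm H (evec (N + b))"
    if "F \<in> vecs H" "homog N F" "coef (component F 0) N = 1" for F N
  proof -
    have "\<forall>\<^sub>F b in sequentially. hnorm H ((mult_op ^^ b) F - evec (N + b)) / hnorm H (evec (N + b)) < 1 / 3"
      by (rule order_tendstoD(2)[OF mult_pow_asymp[OF that]]) simp
    then show ?thesis
      by (simp only: pos_divide_less_eq[OF hnorm_evec_pos] eventually_sequentially)
  qed
  obtain B1 where B1: "\<And>b. b \<ge> B1 \<Longrightarrow> hnorm H ((mult_op ^^ b) F - evec (N + b)) < 1 / 3 * hnorm H (evec (N + b))"
    using ev[OF F] by blast
  obtain B2 where B2: "\<And>b. b \<ge> B2 \<Longrightarrow> hnorm H ((mult_op ^^ b) G - evec (N' + b)) < 1 / 3 * hnorm H (evec (N' + b))"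
    using ev[OF G] by blast
  \<comment> \<open>The summand B1 + B2 puts both exponents beyond both thresholds; adding N' to one
    and N to the other makes the two total degrees equal.\<close>
  define a where "a = B1 + B2 + N'"
  define b where "b = B1 + B2 + N"
  define e where "e = evec (N + a)"
  define r where "r = (mult_op ^^ a) F - e"
  define s where "s = (mult_op ^^ b) G - e"
  have mem: "e \<in> vecs H" "r \<in> vecs H" "s \<in> vecs H"
    using F(1) G(1) by (simp_all add: e_def r_def s_def)
  have e': "e = evec (N' + b)" by (simp add: e_def a_def b_def add.commute add.left_commute)
  have r: "hnorm H r < 1 / 3 * hnorm H e"
    unfolding r_def e_def by (rule B1) (simp add: a_def)
  have s: "hnorm H s < 1 / 3 * hnorm H e"
    unfolding s_def e' by (rule B2) (simp add: b_def)
  have e0: "0 < hnorm H e" unfolding e_def by (rule hnorm_evec_pos)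
  have "ip H ((mult_op ^^ a) F) ((mult_op ^^ b) G) = ip H (r + e) (s + e)"
    by (simp add: r_def s_def)
  also have "\<dots> = ip H e e + (ip H r s + ip H r e + ip H e s)"
    using mem by (simp add: H.ip_add_left H.ip_add_right)
  also have "\<dots> \<noteq> 0"
  proof
    let ?h = "hnorm H e"
    assume "ip H e e + (ip H r s + ip H r e + ip H e s) = 0"
    then have "norm (ip H e e) = norm (ip H r s + ip H r e + ip H e s)"
      by (metis add_eq_0_iff norm_minus_cancel)
    also have "\<dots> \<le> norm (ip H r s) + norm (ip H r e) + norm (ip H e s)"
      by (meson norm_triangle_ineq add_right_mono order_trans)
    also have "\<dots> \<le> hnorm H r * hnorm H s + hnorm H r * ?h + ?h * hnorm H s"
      using mem by (intro add_mono H.cauchy_schwarz)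
    also have "\<dots> \<le> (1/3 * ?h) * (1/3 * ?h) + (1/3 * ?h) * ?h + ?h * (1/3 * ?h)"
      using mem r s e0 by (intro add_mono mult_mono) simp_all
    also have "\<dots> = 7 / 9 * ?h\<^sup>2" by (simp add: power2_eq_square)
    finally have "?h\<^sup>2 \<le> 7 / 9 * ?h\<^sup>2" using mem by (simp add: H.ip_self norm_power)
    then show False using e0 by simp
  qed
  finally have "ip H ((mult_op ^^ a) F) ((mult_op ^^ b) G) \<noteq> 0" .
  moreover have "a + N = b + N'" by (simp add: a_def b_def)
  ultimately show thesis using that by blast
qed

section \<open>Linear combinations of the kernels\<close>

lemma mult_pow_scale: "(mult_op ^^ a) (c *\<^sub>C F) = c *\<^sub>C (mult_op ^^ a) F"
  by (induction a) (simp_all add: mult_op_scale)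

lemma mult_pow_add: "(mult_op ^^ a) (F + G) = (mult_op ^^ a) F + (mult_op ^^ a) G"
proof (induction a)
  case (Suc a)
  have "(mult_op ^^ a) (F + G) = (mult_op ^^ a) F + (mult_op ^^ a) G" by (rule Suc.IH)
  then show "(mult_op ^^ Suc a) (F + G) = (mult_op ^^ Suc a) F + (mult_op ^^ Suc a) G"
    by (simp add: mult_op_add)
qed simp

lemma mult_pow_sum: "(mult_op ^^ a) (\<Sum>i\<in>A. F i) = (\<Sum>i\<in>A. (mult_op ^^ a) (F i))"
proof -
  have "(mult_op ^^ a) 0 = 0" using mult_pow_scale[of a 0 0] by simp
  then show ?thesis
    using sum_comp_morphism[of "mult_op ^^ a" F A] by (simp add: o_def mult_pow_add)
qed

text \<open>Let L be the top degree in F and M the bottom degree in G, with powers chosen so that L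
  + a = M + b. For i \<le> L and j \<ge> M one has i + a \<le> L + a = M + b \<le> j + b, with
  equality throughout only for i = L and j = M; all other terms of the double sum are orthogonal by
  degree.\<close>

lemma zero_kernel_span_not_orthogonal:
  assumes F: "F = (\<Sum>i\<le>m. u i *\<^sub>C zero_kernel i)" "F \<noteq> 0" and G: "G = (\<Sum>i\<le>m. v i *\<^sub>C zero_kernel i)"
    "G \<noteq> 0"
  shows "\<exists>a b. ip H ((mult_op ^^ a) F) ((mult_op ^^ b) G) \<noteq> 0"
proof -
  let ?U = "{i. i \<le> m \<and> u i \<noteq> 0}" and ?V = "{i. i \<le> m \<and> v i \<noteq> 0}"
  have fin: "finite ?U" "finite ?V" by simp_all
  have "?U \<noteq> {}" using F by (auto intro!: sum.neutral)
  note L = Max_in[OF fin(1) this] Max_ge[OF fin(1)]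
  have "?V \<noteq> {}" using G by (auto intro!: sum.neutral)
  note M = Min_in[OF fin(2) this] Min_le[OF fin(2)]
  define L where "L = Max ?U"
  define M where "M = Min ?V"
  obtain a b where ab: "a + L = b + M"
    and nz: "ip H ((mult_op ^^ a) (zero_kernel L)) ((mult_op ^^ b) (zero_kernel M)) \<noteq> 0"
    using mult_pow_not_orthogonal[OF zero_kernel_mem homog_zero_kernel coef_zero_kernel_0 zero_kernel_mem homog_zero_kernel coef_zero_kernel_0] by metis
  define t where "t = (\<lambda>i j. u i * (cnj (v j) * ip H ((mult_op ^^ a) (zero_kernel i)) ((mult_op ^^ b) (zero_kernel j))))"
  have t0: "t i j = 0" if "i \<le> m" "j \<le> m" "\<not> (i = L \<and> j = M)" for i j
  proof (cases "u i = 0 \<or> v j = 0")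
    case False
    then have "i \<le> L" "M \<le> j" using L(2)[of i] M(2)[of j] that by (auto simp: L_def M_def)
    then have "i + a \<noteq> j + b" using ab that(3) by linarith
    then have "ip H ((mult_op ^^ a) (zero_kernel i)) ((mult_op ^^ b) (zero_kernel j)) = 0"
      by (intro homog_orthogonal[of _ _ "i + a" "j + b"] homog_mult_pow homog_zero_kernel mult_pow_mem zero_kernel_mem)
    then show ?thesis by (simp add: t_def)
  qed (auto simp: t_def)
  have "ip H ((mult_op ^^ a) F) ((mult_op ^^ b) G) = (\<Sum>i\<le>m. \<Sum>j\<le>m. t i j)"
    unfolding F(1) G(1) mult_pow_sum mult_pow_scale t_def
    by (subst H.ip_sum_left)
      (simp_all add: H.ip_sum_right H.ip_scale_left H.ip_scale_right sum_distrib_left mult.left_commute)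
  also have "\<dots> = (\<Sum>i\<le>m. if i = L then t L M else 0)"
  proof (intro sum.cong refl)
    fix i assume i: "i \<in> {..m}"
    have "(\<Sum>j\<le>m. t i j) = (\<Sum>j\<le>m. if j = M then t i M else 0)"
      using i t0 by (intro sum.cong refl) auto
    also have "\<dots> = t i M" using M(1) by (simp add: M_def)
    also have "\<dots> = (if i = L then t L M else 0)" using i t0[of i M] M(1) by (auto simp: M_def)
    finally show "(\<Sum>j\<le>m. t i j) = (if i = L then t L M else 0)" .
  qed
  also have "\<dots> = t L M" using L(1) by (simp add: L_def)
  also have "\<dots> \<noteq> 0" using nz L(1) M(1) by (simp add: t_def L_def M_def)
  finally show ?thesis by blast
qed

section \<open>Division by z, the complement of the range, and commuting projections\<close>

lemma mult_op_division:
  assumes F: "F \<in> vecs H" and 0: "\<And>l. l \<le> m \<Longrightarrow> coef (component F l) 0 = 0"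
  obtains G where "G \<in> vecs H" "F = mult_op G"
proof -
  have "\<exists>g. g \<in> vecs (W l) \<and> component F l = zmult g" if "l \<le> m" for l
    using zmult_division[OF lamj_pos H_component_mem[OF F that] 0[OF that]] by metis
  then obtain g where g: "\<And>l. l \<le> m \<Longrightarrow> g l \<in> vecs (W l)" "\<And>l. l \<le> m \<Longrightarrow> component F l = zmult (g l)"
    by metis
  define G where "G = (\<lambda>z l. if l \<le> m then g l z else 0)"
  have G: "component G l = (if l \<le> m then g l else 0)" for l
    by (auto simp: component_def G_def)
  have "G \<in> vecs H" using g by (simp add: vecs_H_iff G)
  moreover have "F = mult_op G"
    using g H_component_eq_0[OF F] by (intro component_eqI) (simp add: G)
  ultimately show thesis by (rule that)
qed

text \<open>Subtract the combination K of kernels having the same values at 0 as F. The difference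
  is divisible by z, hence in the range of \<open>mult_op\<close>, while both F and K are orthogonal
  to that range; so it is orthogonal to itself.\<close>

lemma orthogonal_range_in_zero_kernel_span:
  assumes F: "F \<in> vecs H" and orth: "\<And>G. G \<in> vecs H \<Longrightarrow> ip H F (mult_op G) = 0"
  obtains u where "F = (\<Sum>i\<le>m. u i *\<^sub>C zero_kernel i)"
proof -
  \<comment> \<open>By homogeneity \<open>zero_kernel i\<close> is nonzero at 0 in component i only,
    so the values at 0 can be matched one index at a time. The denominator is the squared norm of
    \<open>zero_kernel i\<close>.\<close>
  define u where "u = (\<lambda>i. coef (component F i) 0 / coef (component (zero_kernel i) i) 0)"
  define K where "K = (\<Sum>i\<le>m. u i *\<^sub>C zero_kernel i)"
  have K: "K \<in> vecs H" unfolding K_def by (intro H.sum_mem H.scale_mem zero_kernel_mem)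
  have "coef (component K l) 0 = coef (component F l) 0" if l: "l \<le> m" for l
  proof -
    have "zero_kernel l \<noteq> 0" using coef_zero_kernel_0[of l] by auto
    then have "ip H (zero_kernel l) (zero_kernel l) \<noteq> 0" using H.ip_pos[of "zero_kernel l"] by auto
    then have nz: "coef (component (zero_kernel l) l) 0 \<noteq> 0" by (simp add: ip_zero_kernel l)
    have "coef (component (zero_kernel i) l) 0 = 0" if "i \<noteq> l" for i
      using homogD[OF homog_zero_kernel l, of 0 i] that by simp
    then have "(\<Sum>i\<le>m. u i * coef (component (zero_kernel i) l) 0) = (\<Sum>i\<le>m. if i = l then u l * coef (component (zero_kernel l) l) 0 else 0)"
      by (intro sum.cong refl) simp
    then have "coef (component K l) 0 = (\<Sum>i\<le>m. if i = l then u l * coef (component (zero_kernel l) l) 0 else 0)"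
      by (simp add: K_def)
    then show ?thesis using nz l by (simp add: u_def)
  qed
  then have "coef (component (F - K) l) 0 = 0" if "l \<le> m" for l
    using that F K by simp
  then obtain G where G: "G \<in> vecs H" "F - K = mult_op G"
    using mult_op_division[OF H.diff_mem[OF F K]] by metis
  have "ip H K (mult_op G) = 0"
  proof -
    have "ip H (zero_kernel i) (mult_op G) = 0" if "i \<le> m" for i
      using H.ip_commute[of "mult_op G" "zero_kernel i"] ip_zero_kernel[of "mult_op G" i] that G(1)
        by simp
    then show ?thesis
      unfolding K_def using G(1) by (simp add: H.ip_sum_left H.ip_scale_left)
  qed
  then have "ip H (F - K) (F - K) = 0"
    using H.ip_diff_left[OF F K, of "mult_op G"] G orth by simp
  then have "F - K = 0" using H.ip_pos[OF H.diff_mem[OF F K]] by auto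
  then show thesis using that[of u] by (simp add: K_def)
qed

text \<open>By self-adjointness Q F is orthogonal to every kernel, so it vanishes at 0 and equals z
  G. Then Q F = Q (Q F) = Q (z G) = z (Q G), and induction on the coefficient index applied to G
  shows that all coefficients vanish. Q stands for P or its complement.\<close>

lemma projection_zero_if_zero_kernel_zero:
  assumes mem: "\<And>F. F \<in> vecs H \<Longrightarrow> Q F \<in> vecs H" and idem: "\<And>F. F \<in> vecs H \<Longrightarrow> Q (Q F) = Q F"
    and sa: "\<And>F G. F \<in> vecs H \<Longrightarrow> G \<in> vecs H \<Longrightarrow> ip H (Q F) G = ip H F (Q G)"
    and comm: "\<And>F. F \<in> vecs H \<Longrightarrow> Q (mult_op F) = mult_op (Q F)"
    and zero_kernel: "\<And>l. l \<le> m \<Longrightarrow> Q (zero_kernel l) = 0" and F: "F \<in> vecs H"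
  shows "Q F = 0"
proof -
  have 0: "coef (component (Q F) l) 0 = 0" if "F \<in> vecs H" "l \<le> m" for F l
    using sa[OF that(1) zero_kernel_mem, of l] zero_kernel[OF that(2)] that
      by (simp add: ip_zero_kernel mem)
  have "coef (component (Q F) l) n = 0" if "F \<in> vecs H" "l \<le> m" for F l n
    using that(1)
  proof (induction n arbitrary: F)
    case 0
    then show ?case using \<open>l \<le> m\<close>
      by (rule \<open>\<And>l F. F \<in> vecs H \<Longrightarrow> l \<le> m \<Longrightarrow> coef (component (Q F) l) 0 = 0\<close>)
  next
    case (Suc n)
    obtain G where G: "G \<in> vecs H" "Q F = mult_op G"
      using mult_op_division[OF mem[OF Suc.prems] 0[OF Suc.prems]] by metis
    have "Q F = Q (mult_op G)" using idem[OF Suc.prems] G(2) by simp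
    then have "Q F = mult_op (Q G)" using comm[OF G(1)] by simp
    then show ?case using Suc.IH[OF G(1)] mem[OF G(1)] by simp
  qed
  then show ?thesis using F mem by (intro H_eqI) simp_all
qed

lemma irreducible_mult_op: "irreducible_operator H mult_op"
  unfolding irreducible_operator_def
proof (intro conjI allI impI bounded_mult_op, elim conjE)
  fix P assume P: "orthogonal_projection H P" and "\<forall>F\<in>vecs H. P (mult_op F) = mult_op (P F)"
  then have comm: "P (mult_op F) = mult_op (P F)" if "F \<in> vecs H" for F using that by blast
  have mem: "P F \<in> vecs H" and idem: "P (P F) = P F" if "F \<in> vecs H" for F
    using P that by (auto simp: orthogonal_projection_def bounded_operator_def)
  have sa: "ip H (P F) G = ip H F (P G)" and padd: "P (F + G) = P F + P G"
    if "F \<in> vecs H" "G \<in> vecs H" for F G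
    using P that by (auto simp: orthogonal_projection_def bounded_operator_def)
  have pscale: "P (c *\<^sub>C F) = c *\<^sub>C P F" if "F \<in> vecs H" for F c
    using P that by (auto simp: orthogonal_projection_def bounded_operator_def)
  have pdiff: "P (F - G) = P F - P G" if "F \<in> vecs H" "G \<in> vecs H" for F G
    unfolding diff_eq_scaleC[of F] diff_eq_scaleC[of "P F"]
    by (simp only: padd[OF that(1) H.scale_mem[OF that(2)]] pscale[OF that(2)])
  define Q where "Q = (\<lambda>F. F - P F)"
  have Qmem: "Q F \<in> vecs H" if "F \<in> vecs H" for F using that mem by (simp add: Q_def)
  have PQ: "P (Q F) = 0" if "F \<in> vecs H" for F
    using that mem by (simp add: Q_def pdiff idem)
  have Qidem: "Q (Q F) = Q F" if "F \<in> vecs H" for F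
    using PQ[OF that] by (simp add: Q_def)
  have Qsa: "ip H (Q F) G = ip H F (Q G)" if "F \<in> vecs H" "G \<in> vecs H" for F G
    using that mem by (simp add: Q_def H.ip_diff_left H.ip_diff_right sa)
  have Qcomm: "Q (mult_op F) = mult_op (Q F)" if "F \<in> vecs H" for F
  proof -
    have "mult_op (F + (-1) *\<^sub>C P F) = mult_op F + (-1) *\<^sub>C mult_op (P F)"
      by (simp only: mult_op_add mult_op_scale)
    then show ?thesis using comm that by (simp add: Q_def scaleC_minus_one)
  qed
  \<comment> \<open>A self-adjoint T commuting with multiplication preserves the complement of its
    range: moving T across turns z G into z (T G), whose components vanish at 0. Stated for
    arbitrary T because it serves both P and Q.\<close>
  have span: "\<exists>u. T (zero_kernel l) = (\<Sum>i\<le>m. u i *\<^sub>C zero_kernel i)"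
    if T: "\<And>F. F \<in> vecs H \<Longrightarrow> T F \<in> vecs H"
      "\<And>F G. F \<in> vecs H \<Longrightarrow> G \<in> vecs H \<Longrightarrow> ip H (T F) G = ip H F (T G)"
      "\<And>F. F \<in> vecs H \<Longrightarrow> T (mult_op F) = mult_op (T F)" and l: "l \<le> m" for T l
  proof -
    have "ip H (T (zero_kernel l)) (mult_op G) = 0" if "G \<in> vecs H" for G
    proof -
      have "ip H (T (zero_kernel l)) (mult_op G) = ip H (zero_kernel l) (mult_op (T G))"
        using that T by simp
      also have "\<dots> = cnj (coef (component (mult_op (T G)) l) 0)"
        using H.ip_commute[of "mult_op (T G)" "zero_kernel l"] ip_zero_kernel[of
          "mult_op (T G)" l] that T(1) l by simp
      finally show ?thesis using that T(1) by simp
    qed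
    then show ?thesis using orthogonal_range_in_zero_kernel_span[OF T(1)[OF zero_kernel_mem]]
      by metis
  qed
  show "(\<forall>F\<in>vecs H. P F = 0) \<or> (\<forall>F\<in>vecs H. P F = F)"
  proof (cases "\<forall>l\<le>m. P (zero_kernel l) = 0")
    case True
    have "P F = 0" if "F \<in> vecs H" for F
      by (rule projection_zero_if_zero_kernel_zero[of P, OF mem idem sa comm _ that]) (use True in simp_all)
    then show ?thesis by blast
  next
    case False
    then obtain l where l: "l \<le> m" "P (zero_kernel l) \<noteq> 0" by blast
    have Q0: "Q (zero_kernel p) = 0" if p: "p \<le> m" for p
    proof (rule ccontr)
      assume nz: "Q (zero_kernel p) \<noteq> 0"
      from span[of P, OF mem sa comm l(1)]
      obtain u where u: "P (zero_kernel l) = (\<Sum>i\<le>m. u i *\<^sub>C zero_kernel i)" ..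
      from span[of Q, OF Qmem Qsa Qcomm p]
      obtain v where v: "Q (zero_kernel p) = (\<Sum>i\<le>m. v i *\<^sub>C zero_kernel i)" ..
      from zero_kernel_span_not_orthogonal[OF u l(2) v nz]
      obtain a b where ab: "ip H ((mult_op ^^ a) (P (zero_kernel l))) ((mult_op ^^ b) (Q (zero_kernel p))) \<noteq> 0"
        by (elim exE)
      have pow: "P ((mult_op ^^ a) F) = (mult_op ^^ a) (P F)" if "F \<in> vecs H" for a F
        using that by (induction a) (simp_all add: comm)
      have zero: "(mult_op ^^ b) 0 = 0" using mult_pow_scale[of b 0 0] by simp
      \<comment> \<open>P commutes with the powers and is self-adjoint, so it can be moved to the
        right-hand vector, where it meets Q and gives 0.\<close>
      have "ip H ((mult_op ^^ a) (P (zero_kernel l))) ((mult_op ^^ b) (Q (zero_kernel p)))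
          = ip H ((mult_op ^^ a) (zero_kernel l)) (P ((mult_op ^^ b) (Q (zero_kernel p))))"
        unfolding pow[OF zero_kernel_mem, symmetric] using Qmem by (intro sa) simp_all
      also have "\<dots> = 0" unfolding pow[OF Qmem[OF zero_kernel_mem]] PQ[OF zero_kernel_mem] zero
        by simp
      finally show False using ab by simp
    qed
    have "Q F = 0" if "F \<in> vecs H" for F
      by (rule projection_zero_if_zero_kernel_zero[of Q, OF Qmem Qidem Qsa Qcomm Q0 that])
    then show ?thesis by (simp add: Q_def)
  qed
qed

end

theorem theorem5p1:
  fixes m :: nat and la :: real and \<mu> :: "nat \<Rightarrow> real"
  assumes "m \<ge> 1"
    and "la > real m / 2"
    and "\<mu> 0 = 1"
    and "\<And>j. 1 \<le> j \<Longrightarrow> j \<le> m \<Longrightarrow> \<mu> j > 0"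
  shows "irreducible_operator (sum_space m la \<mu>) mult_op"
proof -
  interpret weighted_sum_space m la \<mu>
  proof
    show "\<mu> j > 0" if "j \<le> m" for j using assms(3,4) that by (cases "j = 0") simp_all
  qed (rule assms)+
  show ?thesis by (rule irreducible_mult_op)
qed

end
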